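(* The finite volume scheme $$\frac{d}{dt}\boldsymbol U_i=-\frac{\mathcal F_{i+1/2}-\mathcal F_{i-1/2}}{\Delta x}+\boldsymbol S_i,\qquad \boldsymbol S_i=\begin{pmatrix}\boldsymbol 0\\ -\frac{g}{2\Delta x}\left(\mathcal P(\overline{\boldsymbol h}_{i+1/2})[\![\boldsymbol B]\!]_{i+1/2}+\mathcal P(\overline{\boldsymbol h}_{i-1/2})[\![\boldsymbol B]\!]_{i-1/2}\right)\end{pmatrix},$$ with the flux $$\mathcal F_{i+1/2}=\mathcal F^{ES2}_{i+1/2}=\mathcal F^{EC}_{i+1/2}-\tfrac12\,\boldsymbol Q^{ES2}_{i+1/2}\langle\!\langle\boldsymbol V\rangle\!\rangle_{i+1/2},\qquad \boldsymbol Q^{ES2}_{i+1/2}=\boldsymbol T_{i+1/2}|\boldsymbol\Lambda_{i+1/2}|\boldsymbol T_{i+1/2}^\top,$$ where $\langle\!\langle\boldsymbol V\rangle\!\rangle_{i+1/2}=\boldsymbol V^-_{i+1}-\boldsymbol V^+_i$ is the jump of the minmod-limited reconstructions $\boldsymbol V_i^{\pm}$ of the entropy variable in scaled variables, is a second-order, well-balanced, energy stable (ES) scheme.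
   Context: Polynomial chaos setting. Let $\xi\in\mathbb R^d$ be a random variable with Lebesgue density $\rho$ having finite polynomial moments of all orders, and let $\phi_1,\dots,\phi_K$ (with $\phi_1\equiv1$) be polynomials, orthonormal for $\langle f,g\rangle_\rho=\int f g\rho$. For $\widehat z\in\mathbb R^K$ define the symmetric matrix $\mathcal P(\widehat z)=\sum_{k=1}^K\widehat z_k\mathcal M_k\in\mathbb R^{K\times K}$, $(\mathcal M_k)_{\ell,m}=\langle\phi_k,\phi_\ell\phi_m\rangle_\rho$. Stochastic Galerkin shallow water equations (SGSWE). With constant $g>0$, state $\widehat U=(\widehat h^\top,\widehat q^\top)^\top\in\mathbb R^{2K}$ and time-independent bottom coefficients $\widehat B(x)\in\mathbb R^K$, the system is $\widehat U_t+(\widehat F(\widehat U))_x=\widehat S(\widehat U)$ with $$\widehat F(\widehat U)=\begin{pmatrix}\widehat q\\ \mathcal P(\widehat q)\mathcal P(\widehat h)^{-1}\widehat q+\tfrac12 g\mathcal P(\widehat h)\widehat h\end{pmatrix},\qquad \widehat S(\widehat U)=\begin{pmatrix}0\\-g\mathcal P(\widehat h)\widehat{B_x}\end{pmatrix},$$ where $\widehat{B_x}$ is the $x$-derivative of $\widehat B$. Discretization. Uniform mesh with cells $\mathcal I_i=[x_{i-1/2},x_{i+1/2}]$ of length $\Delta x$ and centers $x_i$. Unknowns $\boldsymbol U_i(t)=(\boldsymbol h_i^\top,\boldsymbol q_i^\top)^\top\in\mathbb R^{2K}$ approximate cell averages of $\widehat U$; $\boldsymbol B_i\in\mathbb R^K$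 are the (time-independent) discrete bottom values. The matrices $\mathcal P(\boldsymbol h_i)$ are positive definite for all $i$, and $\boldsymbol u_i=\mathcal P(\boldsymbol h_i)^{-1}\boldsymbol q_i$. For a cell quantity $\boldsymbol a_i$: $\overline{\boldsymbol a}_{i+1/2}=\frac12(\boldsymbol a_i+\boldsymbol a_{i+1})$, $[\![\boldsymbol a]\!]_{i+1/2}=\boldsymbol a_{i+1}-\boldsymbol a_i$. Boundary treatment is not specified. Energy conservative flux: $$\mathcal F^{EC}_{i+1/2}=\begin{pmatrix}\mathcal P(\overline{\boldsymbol h}_{i+1/2})\overline{\boldsymbol u}_{i+1/2}\\ \frac g2\overline{(\mathcal P(\boldsymbol h)\boldsymbol h)}_{i+1/2}+\mathcal P(\overline{\boldsymbol u}_{i+1/2})\mathcal P(\overline{\boldsymbol h}_{i+1/2})\overline{\boldsymbol u}_{i+1/2}\end{pmatrix}.$$ Discrete energy and entropy variable: $$\boldsymbol E_i=\tfrac12(\boldsymbol q_i^\top\boldsymbol u_i+g\|\boldsymbol h_i\|^2)+g\boldsymbol h_i^\top\boldsymbol B_i,\qquad \boldsymbol V_i=\begin{pmatrix}-\frac12\mathcal P(\boldsymbol u_i)\boldsymbol u_i+g(\boldsymbol h_i+\boldsymbol B_i)\\ \boldsymbol u_i\end{pmatrix}.$$ Matrices $\boldsymbol T,\boldsymbol\Lambda$. They come from the eigendecomposition of the flux Jacobian at a Roe-type average state: $$\frac{\partial\widehat F}{\partial\widehat U}(\widetilde{\boldsymbol U}_{i+1/2})=\boldsymbol T_{i+1/2}\boldsymbol\Lambda_{i+1/2}\boldsymbol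 T_{i+1/2}^{-1},\qquad \widetilde{\boldsymbol U}_{i+1/2}=\begin{pmatrix}\overline{\boldsymbol h}_{i+1/2}\\ \mathcal P(\overline{\boldsymbol h}_{i+1/2})\overline{\boldsymbol u}_{i+1/2}\end{pmatrix},$$ with $\boldsymbol\Lambda_{i+1/2}$ diagonal; $|\boldsymbol\Lambda|$ is the entrywise absolute value of the diagonal matrix. Reconstruction. Set $\boldsymbol w_i^{\pm}=\boldsymbol T_{i\pm1/2}^\top\boldsymbol V_i$. For quantities with $\pm$ traces write $\langle\!\langle\boldsymbol a\rangle\!\rangle_{i+1/2}=\boldsymbol a_{i+1}^--\boldsymbol a_i^+$. Let $\phi(\theta)=0$ for $\theta<0$, $\phi(\theta)=\theta$ for $0\le\theta\le1$, $\phi(\theta)=1$ otherwise (minmod limiter, applied elementwise), $\boldsymbol\theta_i^{\pm}=\langle\!\langle\boldsymbol w\rangle\!\rangle_{i\mp1/2}\oslash\langle\!\langle\boldsymbol w\rangle\!\rangle_{i\pm1/2}$ and $$\widetilde{\boldsymbol w}_i^{\pm}=\boldsymbol w_i^{\pm}\pm\tfrac12\,\phi(\boldsymbol\theta_i^{\pm})\circ\langle\!\langle\boldsymbol w\rangle\!\rangle_{i\pm1/2},$$ where $\circ$, $\oslash$ are elementwise multiplication and division. Finally $\boldsymbol V_i^{\pm}$ is defined by $\boldsymbol T_{i\pm1/2}^\top\boldsymbol V_i^{\pm}=\widetilde{\boldsymbol w}_i^{\pm}$. Energy stable (ES): the scheme implies $\frac{d}{dt}\boldsymbol E_i\le-\frac1{\Delta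 x}(\mathcal H_{i+1/2}-\mathcal H_{i-1/2})$ for all $i$, where $\mathcal H_{i+1/2}$ is some numerical entropy flux at the interface $x_{i+1/2}$ (a function of neighboring discrete states and bottom values). Well-balanced: if $\boldsymbol u_i=\boldsymbol 0$ for all $i$ and $\boldsymbol h_i+\boldsymbol B_i$ is the same vector for all $i$, then $\frac{d}{dt}\boldsymbol h_i=\boldsymbol 0$ and $\frac{d}{dt}\boldsymbol q_i=\boldsymbol 0$ for all $i$. Second-order: the local truncation error is $\mathcal O(\Delta x^2)$, i.e. if $(\boldsymbol U_i,\boldsymbol B_i)$ are the exact cell averages of spatially smooth functions $(\widehat U,\widehat B)$ with $\mathcal P(\widehat h)>0$, then $\mathcal F_{i+1/2}-\widehat F(\widehat U)|_{x=x_{i+1/2}}=\mathcal O(\Delta x^2)$ and $\boldsymbol S_i-\widehat S(\widehat U)|_{x=x_i}=\mathcal O(\Delta x^2)$.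
   Formalization: Second order is proved only for smooth profiles along which the eigenvector matrices T are locally bounded and differ by O(Δx) between neighbouring interfaces; for arbitrary column signs or scalings of T the claim is false. Well-balancedness and energy stability need no such condition. *)

theory Defs
  imports "HOL-Probability.Probability"
begin

text \<open>
  The \<open>K\<close> basis functions are indexed by a finite type \<open>'k\<close>, and a state in \<open>R^(2K)\<close> is a vector
  indexed by \<open>'k + 'k\<close>, with the water height at \<open>Inl\<close> and the discharge at \<open>Inr\<close>.
  The mesh is infinite (cells are indexed by \<open>int\<close>), so that there is no boundary treatment.
  In every sequence of interface quantities, index \<open>i\<close> stands for the interface \<open>i + 1/2\<close> between
  the cells \<open>i\<close> and \<open>i + 1\<close>.
\<close>

type_synonym 'k state = "real ^ ('k + 'k)"
type_synonym 'k state_matrix = "real ^ ('k + 'k) ^ ('k + 'k)"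

definition height :: "'k::finite state \<Rightarrow> real ^ 'k" where
  "height U = (\<chi> k. U $ Inl k)"

definition discharge :: "'k::finite state \<Rightarrow> real ^ 'k" where
  "discharge U = (\<chi> k. U $ Inr k)"

definition mk_state :: "real ^ 'k \<Rightarrow> real ^ 'k \<Rightarrow> 'k::finite state" where
  "mk_state h q = (\<chi> s. case s of Inl k \<Rightarrow> h $ k | Inr k \<Rightarrow> q $ k)"


section \<open>Polynomial chaos\<close>

definition inner_density ::
    "(real ^ 'd::finite \<Rightarrow> real) \<Rightarrow> (real ^ 'd \<Rightarrow> real) \<Rightarrow> (real ^ 'd \<Rightarrow> real) \<Rightarrow> real" where
  "inner_density \<rho> f g = (\<integral>x. f x * g x * \<rho> x \<partial>lborel)"

definition pce_triple ::
    "(real ^ 'd::finite \<Rightarrow> real) \<Rightarrow> ('k \<Rightarrow> real ^ 'd \<Rightarrow> real) \<Rightarrow> 'k \<Rightarrow> real ^ 'k::finite ^ 'k" where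
  "pce_triple \<rho> \<phi> k = (\<chi> l m. inner_density \<rho> (\<phi> k) (\<lambda>x. \<phi> l x * \<phi> m x))"

definition pce_matrix ::
    "(real ^ 'd::finite \<Rightarrow> real) \<Rightarrow> ('k \<Rightarrow> real ^ 'd \<Rightarrow> real) \<Rightarrow> real ^ 'k \<Rightarrow> real ^ 'k::finite ^ 'k" where
  "pce_matrix \<rho> \<phi> z = (\<Sum>k\<in>UNIV. z $ k *\<^sub>R pce_triple \<rho> \<phi> k)"

definition pos_def :: "real ^ 'n::finite ^ 'n \<Rightarrow> bool" where
  "pos_def A \<longleftrightarrow> transpose A = A \<and> (\<forall>v. v \<noteq> 0 \<longrightarrow> 0 < v \<bullet> (A *v v))"


section \<open>The stochastic Galerkin shallow water equations\<close>

text \<open>From here on \<open>P\<close> is the map from coefficient vectors to matrices, to be instantiated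
  with \<open>pce_matrix \<rho> \<phi>\<close>.\<close>

definition sg_flux :: "(real ^ 'k \<Rightarrow> real ^ 'k ^ 'k) \<Rightarrow> real \<Rightarrow> 'k::finite state \<Rightarrow> 'k state" where
  "sg_flux P g U =
     (let h = height U; q = discharge U in
      mk_state q (P q *v (matrix_inv (P h) *v q) + (g / 2) *\<^sub>R (P h *v h)))"

definition sg_source ::
    "(real ^ 'k \<Rightarrow> real ^ 'k ^ 'k) \<Rightarrow> real \<Rightarrow> 'k::finite state \<Rightarrow> real ^ 'k \<Rightarrow> 'k state" where
  "sg_source P g U Bx = mk_state 0 (- (g *\<^sub>R (P (height U) *v Bx)))"

definition velocity :: "(real ^ 'k \<Rightarrow> real ^ 'k ^ 'k) \<Rightarrow> 'k::finite state \<Rightarrow> real ^ 'k" where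
  "velocity P U = matrix_inv (P (height U)) *v discharge U"

definition energy ::
    "(real ^ 'k \<Rightarrow> real ^ 'k ^ 'k) \<Rightarrow> real \<Rightarrow> 'k::finite state \<Rightarrow> real ^ 'k \<Rightarrow> real" where
  "energy P g U b =
     (1 / 2) * (discharge U \<bullet> velocity P U + g * (norm (height U))\<^sup>2) + g * (height U \<bullet> b)"

definition entropy_var ::
    "(real ^ 'k \<Rightarrow> real ^ 'k ^ 'k) \<Rightarrow> real \<Rightarrow> 'k::finite state \<Rightarrow> real ^ 'k \<Rightarrow> 'k state" where
  "entropy_var P g U b =
     (let u = velocity P U in
      mk_state (- (1 / 2) *\<^sub>R (P u *v u) + g *\<^sub>R (height U + b)) u)"

text \<open>The flux that the energy is paired with: smooth solutions of the system satisfy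
  \<open>\<partial>\<^sub>t energy + \<partial>\<^sub>x energy_flux = 0\<close>. It only serves to express consistency of numerical
  entropy fluxes.\<close>

definition energy_flux ::
    "(real ^ 'k \<Rightarrow> real ^ 'k ^ 'k) \<Rightarrow> real \<Rightarrow> 'k::finite state \<Rightarrow> real ^ 'k \<Rightarrow> real" where
  "energy_flux P g U b =
     (let u = velocity P U; q = discharge U in
      (1 / 2) * (u \<bullet> (P q *v u)) + g * (q \<bullet> (height U + b)))"


section \<open>Fluxes and source of the scheme\<close>

definition avg :: "(int \<Rightarrow> 'a::real_vector) \<Rightarrow> int \<Rightarrow> 'a" where
  "avg a i = (1 / 2) *\<^sub>R (a i + a (i + 1))"

definition jump :: "(int \<Rightarrow> 'a::real_vector) \<Rightarrow> int \<Rightarrow> 'a" where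
  "jump a i = a (i + 1) - a i"

definition ec_flux ::
    "(real ^ 'k \<Rightarrow> real ^ 'k ^ 'k) \<Rightarrow> real \<Rightarrow> (int \<Rightarrow> 'k::finite state) \<Rightarrow> int \<Rightarrow> 'k state" where
  "ec_flux P g U i =
     (let hm = avg (\<lambda>j. height (U j)) i;
          um = avg (\<lambda>j. velocity P (U j)) i
      in mk_state (P hm *v um)
           ((g / 2) *\<^sub>R avg (\<lambda>j. P (height (U j)) *v height (U j)) i + P um *v (P hm *v um)))"

definition roe_state ::
    "(real ^ 'k \<Rightarrow> real ^ 'k ^ 'k) \<Rightarrow> (int \<Rightarrow> 'k::finite state) \<Rightarrow> int \<Rightarrow> 'k state" where
  "roe_state P U i =
     (let hm = avg (\<lambda>j. height (U j)) i;
          um = avg (\<lambda>j. velocity P (U j)) i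
      in mk_state hm (P hm *v um))"

definition diagonal :: "real ^ 'n::finite ^ 'n \<Rightarrow> bool" where
  "diagonal A \<longleftrightarrow> (\<forall>i j. i \<noteq> j \<longrightarrow> A $ i $ j = 0)"

definition abs_entries :: "real ^ 'n::finite ^ 'n \<Rightarrow> real ^ 'n ^ 'n" where
  "abs_entries A = (\<chi> i j. \<bar>A $ i $ j\<bar>)"

definition minmod :: "real \<Rightarrow> real" where
  "minmod \<theta> = (if \<theta> < 0 then 0 else if \<theta> \<le> 1 then \<theta> else 1)"

text \<open>Limited reconstruction of a cell quantity \<open>V\<close> in variables scaled by interface matrices \<open>R\<close>.
  Traces are attached to cells: \<open>plus\<close> at the right end of cell \<open>i\<close> (interface index \<open>i\<close>),
  \<open>minus\<close> at its left end (interface index \<open>i - 1\<close>). A quotient by zero, which is \<open>0\<close> in HOL, occurs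
  in the slope ratios only in entries where the ratio is afterwards multiplied by that same zero.\<close>

definition scaled_plus ::
    "(int \<Rightarrow> real ^ 'n ^ 'n) \<Rightarrow> (int \<Rightarrow> real ^ 'n::finite) \<Rightarrow> int \<Rightarrow> real ^ 'n" where
  "scaled_plus R V i = transpose (R i) *v V i"

definition scaled_minus ::
    "(int \<Rightarrow> real ^ 'n ^ 'n) \<Rightarrow> (int \<Rightarrow> real ^ 'n::finite) \<Rightarrow> int \<Rightarrow> real ^ 'n" where
  "scaled_minus R V i = transpose (R (i - 1)) *v V i"

definition trace_jump ::
    "(int \<Rightarrow> 'a::real_vector) \<Rightarrow> (int \<Rightarrow> 'a) \<Rightarrow> int \<Rightarrow> 'a" where
  "trace_jump am ap i = am (i + 1) - ap i"

definition scaled_jump ::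
    "(int \<Rightarrow> real ^ 'n ^ 'n) \<Rightarrow> (int \<Rightarrow> real ^ 'n::finite) \<Rightarrow> int \<Rightarrow> real ^ 'n" where
  "scaled_jump R V = trace_jump (scaled_minus R V) (scaled_plus R V)"

definition limited_slope :: "real ^ 'n::finite \<Rightarrow> real ^ 'n \<Rightarrow> real ^ 'n" where
  "limited_slope other own = (\<chi> k. minmod (other $ k / own $ k) * own $ k)"

definition rec_scaled_plus ::
    "(int \<Rightarrow> real ^ 'n ^ 'n) \<Rightarrow> (int \<Rightarrow> real ^ 'n::finite) \<Rightarrow> int \<Rightarrow> real ^ 'n" where
  "rec_scaled_plus R V i =
     scaled_plus R V i
       + (1 / 2) *\<^sub>R limited_slope (scaled_jump R V (i - 1)) (scaled_jump R V i)"

definition rec_scaled_minus ::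
    "(int \<Rightarrow> real ^ 'n ^ 'n) \<Rightarrow> (int \<Rightarrow> real ^ 'n::finite) \<Rightarrow> int \<Rightarrow> real ^ 'n" where
  "rec_scaled_minus R V i =
     scaled_minus R V i
       - (1 / 2) *\<^sub>R limited_slope (scaled_jump R V i) (scaled_jump R V (i - 1))"

definition rec_plus ::
    "(int \<Rightarrow> real ^ 'n ^ 'n) \<Rightarrow> (int \<Rightarrow> real ^ 'n::finite) \<Rightarrow> int \<Rightarrow> real ^ 'n" where
  "rec_plus R V i = matrix_inv (transpose (R i)) *v rec_scaled_plus R V i"

definition rec_minus ::
    "(int \<Rightarrow> real ^ 'n ^ 'n) \<Rightarrow> (int \<Rightarrow> real ^ 'n::finite) \<Rightarrow> int \<Rightarrow> real ^ 'n" where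
  "rec_minus R V i = matrix_inv (transpose (R (i - 1))) *v rec_scaled_minus R V i"

text \<open>\<open>T\<close> and \<open>L\<close> give the eigenvector matrix and the diagonal eigenvalue matrix of the flux Jacobian
  at a state; the scheme evaluates them at the Roe-type states.\<close>

definition es2_flux ::
    "(real ^ 'k \<Rightarrow> real ^ 'k ^ 'k) \<Rightarrow> real
     \<Rightarrow> ('k::finite state \<Rightarrow> 'k state_matrix) \<Rightarrow> ('k state \<Rightarrow> 'k state_matrix)
     \<Rightarrow> (int \<Rightarrow> 'k state) \<Rightarrow> (int \<Rightarrow> real ^ 'k) \<Rightarrow> int \<Rightarrow> 'k state" where
  "es2_flux P g T L U B i =
     (let R = (\<lambda>j. T (roe_state P U j));
          V = (\<lambda>j. entropy_var P g (U j) (B j));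
          Q = R i ** abs_entries (L (roe_state P U i)) ** transpose (R i)
      in ec_flux P g U i - (1 / 2) *\<^sub>R (Q *v trace_jump (rec_minus R V) (rec_plus R V) i))"

definition discrete_source ::
    "(real ^ 'k \<Rightarrow> real ^ 'k ^ 'k) \<Rightarrow> real \<Rightarrow> real
     \<Rightarrow> (int \<Rightarrow> 'k::finite state) \<Rightarrow> (int \<Rightarrow> real ^ 'k) \<Rightarrow> int \<Rightarrow> 'k state" where
  "discrete_source P g dx U B i =
     (let hm = avg (\<lambda>j. height (U j)) in
      mk_state 0
        (- (g / (2 * dx)) *\<^sub>R (P (hm i) *v jump B i + P (hm (i - 1)) *v jump B (i - 1))))"

definition fv_rhs ::
    "((int \<Rightarrow> 'k::finite state) \<Rightarrow> (int \<Rightarrow> real ^ 'k) \<Rightarrow> int \<Rightarrow> 'k state)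
     \<Rightarrow> (real \<Rightarrow> (int \<Rightarrow> 'k state) \<Rightarrow> (int \<Rightarrow> real ^ 'k) \<Rightarrow> int \<Rightarrow> 'k state)
     \<Rightarrow> real \<Rightarrow> (int \<Rightarrow> 'k state) \<Rightarrow> (int \<Rightarrow> real ^ 'k) \<Rightarrow> int \<Rightarrow> 'k state" where
  "fv_rhs \<F> S dx U B i = - ((1 / dx) *\<^sub>R (\<F> U B i - \<F> U B (i - 1))) + S dx U B i"


section \<open>Properties of schemes\<close>

text \<open>The scheme with right-hand side \<open>rhs\<close> holds at the single time \<open>t\<close> (in the time domain \<open>J\<close>,
  so that one-sided derivatives at the ends of a time interval are covered). Energy stability and
  well-balancedness are required whenever this is the case; a solution on \<open>J\<close> satisfies it at
  all times \<open>t \<in> J\<close>.\<close>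

definition scheme_at ::
    "(real ^ 'k \<Rightarrow> real ^ 'k ^ 'k)
     \<Rightarrow> (real \<Rightarrow> (int \<Rightarrow> 'k::finite state) \<Rightarrow> (int \<Rightarrow> real ^ 'k) \<Rightarrow> int \<Rightarrow> 'k state)
     \<Rightarrow> real \<Rightarrow> (real \<Rightarrow> int \<Rightarrow> 'k state) \<Rightarrow> (int \<Rightarrow> real ^ 'k) \<Rightarrow> real set \<Rightarrow> real \<Rightarrow> bool" where
  "scheme_at P rhs dx U B J t \<longleftrightarrow>
     (\<forall>i. pos_def (P (height (U t i)))) \<and>
     (\<forall>i. ((\<lambda>s. U s i) has_vector_derivative rhs dx (U t) B i) (at t within J))"

text \<open>The numerical entropy flux \<open>H\<close> is one function of the states and bottom values in the four
  cells around the interface, the stencil of the flux, and is the same for all interfaces, mesh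
  sizes and solutions. It is consistent with the entropy flux \<open>energy_flux\<close>.\<close>

definition energy_stable ::
    "(real ^ 'k \<Rightarrow> real ^ 'k ^ 'k) \<Rightarrow> real
     \<Rightarrow> (real \<Rightarrow> (int \<Rightarrow> 'k::finite state) \<Rightarrow> (int \<Rightarrow> real ^ 'k) \<Rightarrow> int \<Rightarrow> 'k state) \<Rightarrow> bool" where
  "energy_stable P g rhs \<longleftrightarrow>
     (\<exists>H :: 'k state \<Rightarrow> 'k state \<Rightarrow> 'k state \<Rightarrow> 'k state
            \<Rightarrow> real ^ 'k \<Rightarrow> real ^ 'k \<Rightarrow> real ^ 'k \<Rightarrow> real ^ 'k \<Rightarrow> real.
        (\<forall>U b. pos_def (P (height U)) \<longrightarrow> H U U U U b b b b = energy_flux P g U b) \<and>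
        (\<forall>dx U B J t. 0 < dx \<longrightarrow> scheme_at P rhs dx U B J t \<longrightarrow>
          (let Hi = (\<lambda>i. H (U t (i - 1)) (U t i) (U t (i + 1)) (U t (i + 2))
                           (B (i - 1)) (B i) (B (i + 1)) (B (i + 2)))
           in \<forall>i. \<exists>D. ((\<lambda>s. energy P g (U s i) (B i)) has_real_derivative D) (at t within J) \<and>
                      D \<le> - (1 / dx) * (Hi i - Hi (i - 1)))))"

definition well_balanced ::
    "(real ^ 'k \<Rightarrow> real ^ 'k ^ 'k)
     \<Rightarrow> (real \<Rightarrow> (int \<Rightarrow> 'k::finite state) \<Rightarrow> (int \<Rightarrow> real ^ 'k) \<Rightarrow> int \<Rightarrow> 'k state) \<Rightarrow> bool" where
  "well_balanced P rhs \<longleftrightarrow>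
     (\<forall>dx U B J t. 0 < dx \<longrightarrow> scheme_at P rhs dx U B J t \<longrightarrow>
        (\<forall>i. velocity P (U t i) = 0) \<longrightarrow> (\<exists>c. \<forall>i. height (U t i) + B i = c) \<longrightarrow>
        (\<forall>i. ((\<lambda>s. height (U s i)) has_vector_derivative 0) (at t within J) \<and>
             ((\<lambda>s. discharge (U s i)) has_vector_derivative 0) (at t within J)))"

definition smooth :: "(real \<Rightarrow> 'a::real_normed_vector) \<Rightarrow> bool" where
  "smooth f \<longleftrightarrow>
     (\<exists>D :: nat \<Rightarrow> real \<Rightarrow> 'a. D 0 = f \<and>
        (\<forall>n x. (D n has_vector_derivative D (Suc n) x) (at x)))"

text \<open>Uniform mesh: cell \<open>i\<close> has centre \<open>cell_center x0 dx i\<close> and right end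
  \<open>interface x0 dx i\<close>. The offset \<open>x0\<close> lets meshes of every size be placed anywhere.\<close>

definition cell_center :: "real \<Rightarrow> real \<Rightarrow> int \<Rightarrow> real" where
  "cell_center x0 dx i = x0 + of_int i * dx"

definition interface :: "real \<Rightarrow> real \<Rightarrow> int \<Rightarrow> real" where
  "interface x0 dx i = x0 + (of_int i + 1 / 2) * dx"

definition cell_average ::
    "real \<Rightarrow> real \<Rightarrow> (real \<Rightarrow> 'a::euclidean_space) \<Rightarrow> int \<Rightarrow> 'a" where
  "cell_average x0 dx f i =
     (1 / dx) *\<^sub>R integral {interface x0 dx (i - 1)..interface x0 dx i} f"

text \<open>The truncation errors of flux and source on the profile \<open>(U, B)\<close> are \<open>O(dx\<^sup>2)\<close>, uniformly for
  interfaces and cell centres in a bounded interval.\<close>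

definition second_order_on ::
    "(real ^ 'k \<Rightarrow> real ^ 'k ^ 'k) \<Rightarrow> real
     \<Rightarrow> ((int \<Rightarrow> 'k::finite state) \<Rightarrow> (int \<Rightarrow> real ^ 'k) \<Rightarrow> int \<Rightarrow> 'k state)
     \<Rightarrow> (real \<Rightarrow> (int \<Rightarrow> 'k state) \<Rightarrow> (int \<Rightarrow> real ^ 'k) \<Rightarrow> int \<Rightarrow> 'k state)
     \<Rightarrow> (real \<Rightarrow> 'k state) \<Rightarrow> (real \<Rightarrow> real ^ 'k) \<Rightarrow> bool" where
  "second_order_on P g \<F> S U B \<longleftrightarrow>
     (\<forall>a b. \<exists>C \<delta>. 0 < \<delta> \<and> (\<forall>dx x0 i. 0 < dx \<and> dx < \<delta> \<longrightarrow>
        (let Ui = cell_average x0 dx U; Bi = cell_average x0 dx B;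
             y = interface x0 dx i; x = cell_center x0 dx i
         in (y \<in> {a..b} \<longrightarrow> norm (\<F> Ui Bi i - sg_flux P g (U y)) \<le> C * dx\<^sup>2) \<and>
            (x \<in> {a..b} \<longrightarrow>
               norm (S dx Ui Bi i - sg_source P g (U x) (vector_derivative B (at x))) \<le> C * dx\<^sup>2))))"

text \<open>An eigendecomposition determines the eigenvector matrix only up to order and scaling of its
  columns (and choice of bases of the eigenspaces), and the limiter compares the scaled jumps at two
  neighbouring interfaces componentwise. For this to be meaningful the choices at neighbouring
  interfaces have to match: on the profile \<open>U\<close>, the matrices are bounded and vary by \<open>O(dx)\<close> from
  one interface to the next. This holds, for instance, if \<open>T\<close> is locally Lipschitz near the range
  of \<open>U\<close>. It fails, and so does second order, if signs of columns are flipped arbitrarily.\<close>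

definition coherent_eigenvectors ::
    "(real ^ 'k \<Rightarrow> real ^ 'k ^ 'k) \<Rightarrow> ('k::finite state \<Rightarrow> 'k state_matrix)
     \<Rightarrow> (real \<Rightarrow> 'k state) \<Rightarrow> bool" where
  "coherent_eigenvectors P T U \<longleftrightarrow>
     (\<forall>a b. \<exists>C \<delta>. 0 < \<delta> \<and> (\<forall>dx x0 i. 0 < dx \<and> dx < \<delta> \<and> interface x0 dx i \<in> {a..b} \<longrightarrow>
        (let R = (\<lambda>j. T (roe_state P (cell_average x0 dx U) j))
         in norm (R i) \<le> C \<and> norm (R i - R (i - 1)) \<le> C * dx)))"

end

theory Submission
  imports Defs
begin

text \<open>
  Energy stability: the potential \<open>\<psi> = (g/2) u \<bullet> P(h) h\<close> turns the energy conservative flux into a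
  Tadmor-type identity at each interface, up to the term \<open>g \<langle>u\<rangle> \<bullet> P(\<langle>h\<rangle>) [B]\<close> (averages and jumps)
  that the source supplies. The added diffusion pairs with the jump of the entropy variables to
  \<open>\<Sum>\<^sub>k \<bar>\<lambda>\<^sub>k\<bar> w\<^sub>k w'\<^sub>k \<ge> 0\<close>, since the limiter does not reverse the sign of a scaled jump
  \<open>w\<^sub>k\<close> when passing to the reconstructed one \<open>w'\<^sub>k\<close>. In the lake at rest
  the entropy variables are constant, so the diffusion vanishes, and symmetry of the trilinear form makes flux difference and source cancel.

  Second order: a triple \<open>(l, m, r)\<close> is near-linear if its first differences are \<open>O(dx)\<close> and its second
  difference is \<open>O(dx\<^sup>2)\<close>. This is inherited by bilinear expressions and by solutions \<open>u\<close> of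
  \<open>P(h) u = q\<close> with uniformly coercive \<open>P(h)\<close>, and holds for cell averages of smooth functions. Applied to
  two cells and the interface point between them, it gives consistency of the averages. Applied to
  three consecutive cells, it bounds second differences of the entropy variables, hence by coherence
  differences of neighbouring scaled jumps, and these control the limited jump. The diffusion is then
  \<open>O(dx\<^sup>2)\<close>, because the eigenvalues of the Jacobian are bounded.
\<close>

section \<open>Estimates uniform in a parameter\<close>

text \<open>One constant serves the whole set \<open>X\<close> of parameters instead of a limit
  along a filter; with mesh size, offset and cell index as parameter this is the uniformity that
  \<open>second_order_on\<close> demands. The sign of \<open>C\<close> is left open.\<close>

definition bigo_on :: "'p set \<Rightarrow> ('p \<Rightarrow> real) \<Rightarrow> ('p \<Rightarrow> 'a::real_normed_vector) \<Rightarrow> bool" where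
  "bigo_on X e f \<longleftrightarrow> (\<exists>C. \<forall>p\<in>X. norm (f p) \<le> C * e p)"

lemma bigo_onI: "(\<And>p. p \<in> X \<Longrightarrow> norm (f p) \<le> C * e p) \<Longrightarrow> bigo_on X e f"
  unfolding bigo_on_def by blast

lemma bigo_onE:
  assumes "bigo_on X e f"
  obtains C where "\<And>p. p \<in> X \<Longrightarrow> norm (f p) \<le> C * e p"
  using assms unfolding bigo_on_def by blast

lemma bigo_on_cong:
  assumes "bigo_on X e f" "\<And>p. p \<in> X \<Longrightarrow> f p = f' p" "\<And>p. p \<in> X \<Longrightarrow> e p = e' p"
  shows "bigo_on X e' f'"
  using assms unfolding bigo_on_def by metis

lemma bigo_on_subset: "bigo_on X e f \<Longrightarrow> Y \<subseteq> X \<Longrightarrow> bigo_on Y e f"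
  unfolding bigo_on_def by blast

lemma bigo_on_mono:
  assumes "bigo_on X e f" "\<And>p. p \<in> X \<Longrightarrow> 0 \<le> e p \<and> e p \<le> e' p"
  shows "bigo_on X e' f"
proof -
  obtain C where C: "\<And>p. p \<in> X \<Longrightarrow> norm (f p) \<le> C * e p"
    using bigo_onE[OF assms(1)] by blast
  show ?thesis
  proof (rule bigo_onI)
    fix p assume p: "p \<in> X"
    have "norm (f p) \<le> C * e p" by (rule C[OF p])
    \<comment> \<open>\<open>C\<close> may be negative, so it is made nonnegative before
      \<open>e p\<close> is enlarged.\<close>
    also have "\<dots> \<le> \<bar>C\<bar> * e p" using assms(2)[OF p] by (simp add: mult_right_mono)
    also have "\<dots> \<le> \<bar>C\<bar> * e' p" using assms(2)[OF p] by (simp add: mult_left_mono)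
    finally show "norm (f p) \<le> \<bar>C\<bar> * e' p" .
  qed
qed

lemma bigo_on_add:
  assumes "bigo_on X e f" "bigo_on X e g"
  shows "bigo_on X e (\<lambda>p. f p + g p)"
proof -
  obtain C D where "\<And>p. p \<in> X \<Longrightarrow> norm (f p) \<le> C * e p" "\<And>p. p \<in> X \<Longrightarrow> norm (g p) \<le> D * e p"
    using bigo_onE[OF assms(1)] bigo_onE[OF assms(2)] by metis
  then show ?thesis
    by (intro bigo_onI[where C = "C + D"]) (auto simp: distrib_right intro: norm_add_rule_thm)
qed

lemma bigo_on_uminus: "bigo_on X e f \<Longrightarrow> bigo_on X e (\<lambda>p. - f p)"
  unfolding bigo_on_def by simp

lemma bigo_on_diff:
  "bigo_on X e f \<Longrightarrow> bigo_on X e g \<Longrightarrow> bigo_on X e (\<lambda>p. f p - g p)"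
  using bigo_on_add[OF _ bigo_on_uminus] by fastforce

lemma bigo_on_bilinear:
  assumes "bounded_bilinear bil" "bigo_on X e f" "bigo_on X e' g"
  shows "bigo_on X (\<lambda>p. e p * e' p) (\<lambda>p. bil (f p) (g p))"
proof -
  obtain C D where C: "\<And>p. p \<in> X \<Longrightarrow> norm (f p) \<le> C * e p"
    and D: "\<And>p. p \<in> X \<Longrightarrow> norm (g p) \<le> D * e' p"
    using bigo_onE[OF assms(2)] bigo_onE[OF assms(3)] by metis
  obtain K where K: "0 < K" "\<And>a b. norm (bil a b) \<le> norm a * norm b * K"
    using bounded_bilinear.pos_bounded[OF assms(1)] by blast
  show ?thesis
  proof (rule bigo_onI)
    fix p assume p: "p \<in> X"
    have "norm (bil (f p) (g p)) \<le> norm (f p) * norm (g p) * K" by (rule K)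
    also have "\<dots> \<le> ((C * e p) * (D * e' p)) * K"
      using K(1) C[OF p] D[OF p] order_trans[OF norm_ge_zero C[OF p]]
      by (intro mult_right_mono mult_mono) auto
    finally show "norm (bil (f p) (g p)) \<le> C * D * K * (e p * e' p)" by (simp add: mult_ac)
  qed
qed

lemma bigo_on_linear:
  assumes "bounded_linear h" "bigo_on X e f"
  shows "bigo_on X e (\<lambda>p. h (f p))"
proof -
  obtain C where C: "\<And>p. p \<in> X \<Longrightarrow> norm (f p) \<le> C * e p"
    using bigo_onE[OF assms(2)] by blast
  obtain K where K: "0 < K" "\<And>a. norm (h a) \<le> norm a * K"
    using bounded_linear.pos_bounded[OF assms(1)] by blast
  show ?thesis
  proof (rule bigo_onI)
    fix p assume p: "p \<in> X"
    show "norm (h (f p)) \<le> C * K * e p"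
      using order_trans[OF K(2)[of "f p"] mult_right_mono[OF C[OF p], of K]] K(1) by (simp add: mult_ac)
  qed
qed

lemmas bigo_on_scaleR = bigo_on_linear[OF bounded_linear_scaleR_right]

lemma bigo_on_self: "bigo_on X e (e :: 'p \<Rightarrow> real)" if "\<And>p. p \<in> X \<Longrightarrow> 0 \<le> e p"
  by (rule bigo_onI[where C = 1]) (simp add: that)

text \<open>Telescoping through the mixed product \<open>bil f' g\<close>: each summand has one
  small and one bounded factor.\<close>

lemma bigo_on_product_diff:
  assumes "bounded_bilinear bil"
    and "bigo_on X e (\<lambda>p. f p - f' p)" "bigo_on X e (\<lambda>p. g p - g' p)"
    and "bigo_on X (\<lambda>_. 1) g" "bigo_on X (\<lambda>_. 1) f'"
  shows "bigo_on X e (\<lambda>p. bil (f p) (g p) - bil (f' p) (g' p))"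
proof -
  interpret bounded_bilinear bil by fact
  have "bigo_on X e (\<lambda>p. bil (f p - f' p) (g p))"
    using bigo_on_bilinear[OF assms(1,2,4)] by simp
  moreover have "bigo_on X e (\<lambda>p. bil (f' p) (g p - g' p))"
    using bigo_on_bilinear[OF assms(1,5,3)] by simp
  ultimately show ?thesis
    by (rule bigo_on_cong[OF bigo_on_add]) (auto simp: diff_left diff_right)
qed

section \<open>Near-linear triples: a calculus of first and second differences\<close>

definition near_linear ::
    "'p set \<Rightarrow> ('p \<Rightarrow> real) \<Rightarrow> ('p \<Rightarrow> 'a::real_normed_vector) \<Rightarrow> ('p \<Rightarrow> 'a) \<Rightarrow> ('p \<Rightarrow> 'a) \<Rightarrow> bool" where
  "near_linear X d l m r \<longleftrightarrow>
     bigo_on X (\<lambda>_. 1) m \<and> bigo_on X d (\<lambda>p. l p - m p) \<and> bigo_on X d (\<lambda>p. r p - m p) \<and>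
     bigo_on X (\<lambda>p. (d p)\<^sup>2) (\<lambda>p. l p + r p - 2 *\<^sub>R m p)"

lemma near_linear_subset: "near_linear X d l m r \<Longrightarrow> Y \<subseteq> X \<Longrightarrow> near_linear Y d l m r"
  unfolding near_linear_def using bigo_on_subset by blast

lemma near_linear_add:
  assumes "near_linear X d l m r" "near_linear X d l' m' r'"
  shows "near_linear X d (\<lambda>p. l p + l' p) (\<lambda>p. m p + m' p) (\<lambda>p. r p + r' p)"
proof -
  note nl = assms[unfolded near_linear_def]
  show ?thesis unfolding near_linear_def
  proof (intro conjI)
    show "bigo_on X (\<lambda>_. 1) (\<lambda>p. m p + m' p)"
      using nl by (blast intro: bigo_on_add)
    show "bigo_on X d (\<lambda>p. l p + l' p - (m p + m' p))"
      using bigo_on_add[of X d "\<lambda>p. l p - m p" "\<lambda>p. l' p - m' p"] nl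
      by (simp add: algebra_simps)
    show "bigo_on X d (\<lambda>p. r p + r' p - (m p + m' p))"
      using bigo_on_add[of X d "\<lambda>p. r p - m p" "\<lambda>p. r' p - m' p"] nl
      by (simp add: algebra_simps)
    show "bigo_on X (\<lambda>p. (d p)\<^sup>2) (\<lambda>p. l p + l' p + (r p + r' p) - 2 *\<^sub>R (m p + m' p))"
      using bigo_on_add[of X "\<lambda>p. (d p)\<^sup>2" "\<lambda>p. l p + r p - 2 *\<^sub>R m p"
          "\<lambda>p. l' p + r' p - 2 *\<^sub>R m' p"] nl
      by (simp add: algebra_simps)
  qed
qed

lemma near_linear_linear:
  assumes "bounded_linear h" "near_linear X d l m r"
  shows "near_linear X d (\<lambda>p. h (l p)) (\<lambda>p. h (m p)) (\<lambda>p. h (r p))"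
proof -
  interpret bounded_linear h by fact
  show ?thesis
    using assms(2) bigo_on_linear[OF assms(1)] unfolding near_linear_def
    by (auto simp: diff[symmetric] add[symmetric] scaleR[symmetric])
qed

text \<open>A discrete Leibniz rule. After expanding about the middle entries, the second difference
  of the product consists of the two second differences, each paired with a middle entry, and two
  products of first differences, which are of order \<open>d * d\<close>.\<close>

lemma near_linear_bilinear:
  assumes "bounded_bilinear bil" "near_linear X d l m r" "near_linear X d l' m' r'"
    and d: "\<And>p. p \<in> X \<Longrightarrow> 0 \<le> d p \<and> d p \<le> 1"
  shows "near_linear X d (\<lambda>p. bil (l p) (l' p)) (\<lambda>p. bil (m p) (m' p)) (\<lambda>p. bil (r p) (r' p))"
proof -
  interpret bounded_bilinear bil by fact
  note P = bigo_on_bilinear[OF assms(1)]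
  \<comment> \<open>Since \<open>d \<le> 1\<close>, second-order terms also count as first-order
    ones.\<close>
  have d2: "bigo_on X (\<lambda>p. (d p)\<^sup>2) f \<Longrightarrow> bigo_on X d f" for f :: "'d \<Rightarrow> 'c"
    by (rule bigo_on_mono) (use d in \<open>auto simp: power2_eq_square mult_left_le\<close>)
  note nl = assms(2,3)[unfolded near_linear_def]
  have ll: "bigo_on X (\<lambda>p. (d p)\<^sup>2) (\<lambda>p. bil (l p - m p) (l' p - m' p))"
    and rr: "bigo_on X (\<lambda>p. (d p)\<^sup>2) (\<lambda>p. bil (r p - m p) (r' p - m' p))"
    using nl by (auto simp: power2_eq_square intro: P)
  have lm: "bigo_on X d (\<lambda>p. bil (l p - m p) (m' p))" "bigo_on X d (\<lambda>p. bil (m p) (l' p - m' p))"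
    "bigo_on X d (\<lambda>p. bil (r p - m p) (m' p))" "bigo_on X d (\<lambda>p. bil (m p) (r' p - m' p))"
    using nl P[where e = d and e' = "\<lambda>_. 1"] P[where e = "\<lambda>_. 1" and e' = d] by auto
  have s: "bigo_on X (\<lambda>p. (d p)\<^sup>2) (\<lambda>p. bil (l p + r p - 2 *\<^sub>R m p) (m' p))"
    "bigo_on X (\<lambda>p. (d p)\<^sup>2) (\<lambda>p. bil (m p) (l' p + r' p - 2 *\<^sub>R m' p))"
    using nl P[where e = "\<lambda>p. (d p)\<^sup>2" and e' = "\<lambda>_. 1"] P[where e = "\<lambda>_. 1" and e' = "\<lambda>p. (d p)\<^sup>2"]
    by auto
  note bls = add_left add_right diff_left diff_right scaleR_left scaleR_right
  show ?thesis unfolding near_linear_def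
  proof (intro conjI)
    show "bigo_on X (\<lambda>_. 1) (\<lambda>p. bil (m p) (m' p))"
      using nl P[where e = "\<lambda>_. 1" and e' = "\<lambda>_. 1"] by auto
    show "bigo_on X d (\<lambda>p. bil (l p) (l' p) - bil (m p) (m' p))"
      by (rule bigo_on_cong[OF bigo_on_add[OF bigo_on_add[OF lm(1,2)] d2[OF ll]]])
        (auto simp: bls)
    show "bigo_on X d (\<lambda>p. bil (r p) (r' p) - bil (m p) (m' p))"
      by (rule bigo_on_cong[OF bigo_on_add[OF bigo_on_add[OF lm(3,4)] d2[OF rr]]])
        (auto simp: bls)
    show "bigo_on X (\<lambda>p. (d p)\<^sup>2)
            (\<lambda>p. bil (l p) (l' p) + bil (r p) (r' p) - 2 *\<^sub>R bil (m p) (m' p))"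
      by (rule bigo_on_cong[OF bigo_on_add[OF bigo_on_add[OF ll rr] bigo_on_add[OF s]]])
        (auto simp: bls scaleR_2)
  qed
qed

lemma near_linear_midpoint:
  assumes "near_linear X d l m r"
  shows "bigo_on X (\<lambda>p. (d p)\<^sup>2) (\<lambda>p. (1 / 2) *\<^sub>R (l p + r p) - m p)"
proof -
  have "bigo_on X (\<lambda>p. (d p)\<^sup>2) (\<lambda>p. (1 / 2) *\<^sub>R (l p + r p - 2 *\<^sub>R m p))"
    using assms unfolding near_linear_def by (intro bigo_on_scaleR) simp
  then show ?thesis
    by (rule bigo_on_cong) (simp_all add: scaleR_diff_right)
qed

lemma near_linear_bounded:
  assumes "near_linear X d l m r" and d: "\<And>p. p \<in> X \<Longrightarrow> 0 \<le> d p \<and> d p \<le> 1"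
  shows "bigo_on X (\<lambda>_. 1) l" "bigo_on X (\<lambda>_. 1) m" "bigo_on X (\<lambda>_. 1) r"
proof -
  note nl = assms(1)[unfolded near_linear_def]
  show m: "bigo_on X (\<lambda>_. 1) m" using nl by blast
  have "bigo_on X (\<lambda>_. 1) (\<lambda>p. l p - m p)" "bigo_on X (\<lambda>_. 1) (\<lambda>p. r p - m p)"
    using nl d by (auto elim!: bigo_on_mono)
  from this[THEN bigo_on_add[OF _ m]]
  show "bigo_on X (\<lambda>_. 1) l" "bigo_on X (\<lambda>_. 1) r" by simp_all
qed

text \<open>All three entries are expanded to first order about the same base value
  \<open>A\<close>. With \<open>sm\<close> the mean of \<open>sl\<close> and \<open>sr\<close>, the
  linear terms cancel in the second difference. This covers three consecutive cells as well as two
  cells and the interface between them.\<close>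

lemma near_linear_expansion:
  assumes A: "bigo_on X (\<lambda>_. 1) A" "bigo_on X (\<lambda>_. 1) A'"
    and l: "bigo_on X (\<lambda>p. (d p)\<^sup>2) (\<lambda>p. l p - A p - (sl * d p) *\<^sub>R A' p)"
    and m: "bigo_on X (\<lambda>p. (d p)\<^sup>2) (\<lambda>p. m p - A p - (sm * d p) *\<^sub>R A' p)"
    and r: "bigo_on X (\<lambda>p. (d p)\<^sup>2) (\<lambda>p. r p - A p - (sr * d p) *\<^sub>R A' p)"
    and s: "sl + sr = 2 * sm"
    and d: "\<And>p. p \<in> X \<Longrightarrow> 0 \<le> d p \<and> d p \<le> 1"
  shows "near_linear X d l m r"
proof -
  have d2: "bigo_on X (\<lambda>p. (d p)\<^sup>2) f \<Longrightarrow> bigo_on X d f" for f :: "'a \<Rightarrow> 'b"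
    by (rule bigo_on_mono) (use d in \<open>auto simp: power2_eq_square mult_left_le\<close>)
  have d1: "bigo_on X d f \<Longrightarrow> bigo_on X (\<lambda>_. 1) f" for f :: "'a \<Rightarrow> 'b"
    by (rule bigo_on_mono) (use d in auto)
  have A's: "bigo_on X d (\<lambda>p. (s * d p) *\<^sub>R A' p)" for s
    using bigo_on_scaleR[OF bigo_on_bilinear[OF bounded_bilinear_scaleR bigo_on_self A(2)],
        of d s] d by simp
  show ?thesis unfolding near_linear_def
  proof (intro conjI)
    show "bigo_on X (\<lambda>_. 1) m"
      by (rule bigo_on_cong[OF bigo_on_add[OF A(1) d1[OF bigo_on_add[OF d2[OF m] A's[of sm]]]]]) auto
    show "bigo_on X d (\<lambda>p. l p - m p)"
      by (rule bigo_on_cong[OF bigo_on_add[OF bigo_on_diff[OF d2[OF l] d2[OF m]] A's[of "sl - sm"]]])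
        (auto simp: algebra_simps)
    show "bigo_on X d (\<lambda>p. r p - m p)"
      by (rule bigo_on_cong[OF bigo_on_add[OF bigo_on_diff[OF d2[OF r] d2[OF m]] A's[of "sr - sm"]]])
        (auto simp: algebra_simps)
    have "l p - A p - (sl * d p) *\<^sub>R A' p + (r p - A p - (sr * d p) *\<^sub>R A' p)
        - 2 *\<^sub>R (m p - A p - (sm * d p) *\<^sub>R A' p) = l p + r p - 2 *\<^sub>R m p" for p
    proof -
      have "(sl * d p) *\<^sub>R A' p + (sr * d p) *\<^sub>R A' p = 2 *\<^sub>R ((sm * d p) *\<^sub>R A' p)"
        using s by (simp add: scaleR_add_left[symmetric] distrib_right[symmetric])
      then show ?thesis by (simp add: algebra_simps scaleR_2)
    qed
    then show "bigo_on X (\<lambda>p. (d p)\<^sup>2) (\<lambda>p. l p + r p - 2 *\<^sub>R m p)"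
      by (intro bigo_on_cong[OF bigo_on_diff[OF bigo_on_add[OF l r] bigo_on_scaleR[OF m, of 2]]]) auto
  qed
qed

section \<open>Taylor expansion of cell averages\<close>

text \<open>Induction on the order: the derivative of the remainder of order \<open>Suc n\<close> is
  the remainder of order \<open>n\<close> of the shifted sequence, and the mean value inequality
  passes the bound on. The increment \<open>r\<close> may be negative, hence the closed
  segment.\<close>

lemma taylor_bound:
  fixes D :: "nat \<Rightarrow> real \<Rightarrow> 'a::real_normed_vector"
  assumes "\<And>n x. (D n has_vector_derivative D (Suc n) x) (at x)"
    and "\<And>y. y \<in> closed_segment x (x + r) \<Longrightarrow> norm (D n y) \<le> C"
  shows "norm (D 0 (x + r) - (\<Sum>k<n. (r ^ k / fact k) *\<^sub>R D k x)) \<le> C * \<bar>r\<bar> ^ n"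
  using assms
proof (induction n arbitrary: D r)
  case 0
  then show ?case by simp
next
  case (Suc n)
  define e where "e = (\<lambda>s. D 0 (x + s) - (\<Sum>k<Suc n. (s ^ k / fact k) *\<^sub>R D k x))"
  define e' where "e' = (\<lambda>s. D 1 (x + s) - (\<Sum>k<n. (s ^ k / fact k) *\<^sub>R D (Suc k) x))"
  have C: "0 \<le> C" using order_trans[OF norm_ge_zero Suc.prems(2)[of x]] by simp
  have pow: "((\<lambda>s. (s ^ Suc k / fact (Suc k)) *\<^sub>R v) has_vector_derivative (s ^ k / fact k) *\<^sub>R v) (at s)"
    for k and s :: real and v :: 'a
  proof -
    have "((\<lambda>s. s ^ Suc k / fact (Suc k)) has_real_derivative real (Suc k) * s ^ k / fact (Suc k)) (at s)"
      using DERIV_cdivide[OF DERIV_pow[of "Suc k" s UNIV], of "fact (Suc k)"] by simp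
    moreover have "real (Suc k) * s ^ k / fact (Suc k) = s ^ k / fact k"
      by (simp add: fact_Suc del: of_nat_Suc)
    ultimately show ?thesis
      using has_vector_derivative_scaleR[OF _ has_vector_derivative_const] by fastforce
  qed
  have shift: "((\<lambda>s. D 0 (x + s)) has_vector_derivative D 1 (x + s)) (at s)" for s
  proof -
    have "((\<lambda>s. x + s) has_vector_derivative 1) (at s)" by (auto intro!: derivative_eq_intros)
    from vector_diff_chain_at[OF this] Suc.prems(1)[of 0 "x + s"] show ?thesis
      by (auto simp: o_def)
  qed
  have e: "(e has_vector_derivative e' s) (at s)" for s
  proof -
    have "((\<lambda>s. D 0 (x + s) - (D 0 x + (\<Sum>k<n. (s ^ Suc k / fact (Suc k)) *\<^sub>R D (Suc k) x)))
        has_vector_derivative D 1 (x + s) - (0 + (\<Sum>k<n. (s ^ k / fact k) *\<^sub>R D (Suc k) x))) (at s)"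
      by (intro has_vector_derivative_diff has_vector_derivative_add has_vector_derivative_const
          has_vector_derivative_sum pow shift)
    then show ?thesis
      by (simp add: e_def e'_def sum.lessThan_Suc_shift del: sum.lessThan_Suc fact_Suc power_Suc)
  qed
  have e': "norm (e' s) \<le> C * \<bar>r\<bar> ^ n" if s: "s \<in> closed_segment 0 r" for s
  proof -
    have s': "\<bar>s\<bar> \<le> \<bar>r\<bar>" using s by (auto simp: closed_segment_eq_real_ivl split: if_splits)
    have "norm (e' s) \<le> C * \<bar>s\<bar> ^ n"
      unfolding e'_def One_nat_def
      using Suc.prems s
      by (intro Suc.IH[of "\<lambda>k. D (Suc k)"])
        (auto simp: closed_segment_eq_real_ivl split: if_splits)
    also have "\<dots> \<le> C * \<bar>r\<bar> ^ n" using s' C by (intro mult_left_mono power_mono) auto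
    finally show ?thesis .
  qed
  have "norm (e r - e 0) \<le> C * \<bar>r\<bar> ^ n * norm (r - 0)"
  proof (rule differentiable_bound[of "closed_segment 0 r" e "\<lambda>s h. h *\<^sub>R e' s"])
    show "(e has_derivative (\<lambda>h. h *\<^sub>R e' s)) (at s within closed_segment 0 r)" for s
      using e has_vector_derivative_at_within has_vector_derivative_def by blast
    show "onorm (\<lambda>h. h *\<^sub>R e' s) \<le> C * \<bar>r\<bar> ^ n" if "s \<in> closed_segment 0 r" for s
      using e'[OF that] C by (intro onorm_bound) (auto simp: mult.commute mult_left_mono)
  qed auto
  moreover have "e 0 = 0" by (simp add: e_def sum.lessThan_Suc_shift del: sum.lessThan_Suc)
  ultimately show ?case by (simp add: e_def mult_ac)
qed

text \<open>Putting an antiderivative in front of the sequence turns cell averages into difference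
  quotients of \<open>\<beta>\<close>, to which the same Taylor bound applies.\<close>

lemma derivatives_antiderivative:
  fixes D :: "nat \<Rightarrow> real \<Rightarrow> 'a::euclidean_space"
  assumes "\<And>n x. (D n has_vector_derivative D (Suc n) x) (at x)"
  obtains \<beta> where "\<And>n x. (case_nat \<beta> D n has_vector_derivative case_nat \<beta> D (Suc n) x) (at x)"
proof -
  have "\<exists>\<beta>. \<forall>x::real. -\<infinity> < ereal x \<longrightarrow> ereal x < \<infinity> \<longrightarrow> (\<beta> has_vector_derivative D 0 x) (at x)"
    using assms[of 0] by (intro einterval_antiderivative)
      (auto intro: differentiable_imp_continuous_within differentiableI_vector)
  then obtain \<beta> where "\<And>x. (\<beta> has_vector_derivative D 0 x) (at x)" by auto
  then have "(case_nat \<beta> D n has_vector_derivative case_nat \<beta> D (Suc n) x) (at x)" for n x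
    using assms by (cases n) auto
  then show thesis by (rule that)
qed

text \<open>A mesh point \<open>(dx, x0, i)\<close> consists of the mesh size, the offset and a cell index.\<close>

definition center :: "real \<times> real \<times> int \<Rightarrow> real" where
  "center p = cell_center (fst (snd p)) (fst p) (snd (snd p))"

text \<open>The bound \<open>1\<close> on the mesh size makes higher powers of it smaller and keeps
  every fixed stencil around the centers inside one bounded interval.\<close>

definition mesh :: "real \<Rightarrow> real \<Rightarrow> (real \<times> real \<times> int) set" where
  "mesh a b = {p. 0 < fst p \<and> fst p < 1 \<and> center p \<in> {a..b}}"

text \<open>\<open>k\<close> is an offset from the cell of \<open>p\<close>: neighbouring cells are
  compared at one mesh point, whose center is the base point of all expansions.\<close>

definition avg_at :: "(real \<Rightarrow> 'a::euclidean_space) \<Rightarrow> int \<Rightarrow> real \<times> real \<times> int \<Rightarrow> 'a" where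
  "avg_at f k p = cell_average (fst (snd p)) (fst p) f (snd (snd p) + k)"

lemma mesh_size: "p \<in> mesh a b \<Longrightarrow> 0 < fst p \<and> fst p < 1 \<and> 0 \<le> fst p \<and> fst p \<le> 1"
  by (auto simp: mesh_def)

lemma derivatives_bounded:
  fixes D :: "nat \<Rightarrow> real \<Rightarrow> 'a::real_normed_vector"
  assumes "\<And>n x. (D n has_vector_derivative D (Suc n) x) (at x)"
  obtains C where "\<And>y. y \<in> {a..b} \<Longrightarrow> norm (D n y) \<le> C"
proof -
  have "continuous_on {a..b} (D n)"
    using assms[of n] by (intro continuous_at_imp_continuous_on)
      (auto intro: differentiable_imp_continuous_within differentiableI_vector)
  then have "bounded (D n ` {a..b})"
    by (intro compact_imp_bounded compact_continuous_image) auto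
  then obtain C where "\<forall>y\<in>D n ` {a..b}. norm y \<le> C"
    unfolding bounded_iff by blast
  then have "\<And>y. y \<in> {a..b} \<Longrightarrow> norm (D n y) \<le> C" by blast
  then show thesis by (rule that)
qed

lemma derivatives_bigo:
  fixes D :: "nat \<Rightarrow> real \<Rightarrow> 'a::real_normed_vector"
  assumes "\<And>n x. (D n has_vector_derivative D (Suc n) x) (at x)"
  shows "bigo_on (mesh a b) (\<lambda>_. 1) (\<lambda>p. D n (center p))"
proof -
  obtain C where C: "\<And>y. y \<in> {a..b} \<Longrightarrow> norm (D n y) \<le> C"
    using derivatives_bounded[of D, OF assms] by blast
  then show ?thesis by (intro bigo_onI[where C = C]) (auto simp: mesh_def)
qed

lemma mesh_taylor:
  fixes D :: "nat \<Rightarrow> real \<Rightarrow> 'a::real_normed_vector"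
  assumes "\<And>n x. (D n has_vector_derivative D (Suc n) x) (at x)"
  shows "bigo_on (mesh a b) (\<lambda>p. fst p ^ n)
           (\<lambda>p. D 0 (center p + s * fst p) - (\<Sum>k<n. ((s * fst p) ^ k / fact k) *\<^sub>R D k (center p)))"
proof -
  \<comment> \<open>The points \<open>center p + s * fst p\<close> stay within distance
    \<open>\<bar>s\<bar>\<close> of \<open>{a..b}\<close>, because the mesh size is below
    \<open>1\<close>.\<close>
  obtain C where C: "\<And>y. y \<in> {a - \<bar>s\<bar>..b + \<bar>s\<bar>} \<Longrightarrow> norm (D n y) \<le> C"
    using derivatives_bounded[of D, OF assms] by blast
  show ?thesis
  proof (rule bigo_onI[where C = "C * \<bar>s\<bar> ^ n"])
    fix p assume p: "p \<in> mesh a b"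
    have "\<bar>s * fst p\<bar> \<le> \<bar>s\<bar>"
      using mesh_size[OF p] by (simp add: abs_mult mult_left_le)
    then have "norm (D n y) \<le> C" if "y \<in> closed_segment (center p) (center p + s * fst p)" for y
      using that p
      by (intro C) (auto simp: mesh_def closed_segment_eq_real_ivl split: if_splits)
    from taylor_bound[of D "center p" "s * fst p", OF assms this]
    show "norm (D 0 (center p + s * fst p) - (\<Sum>k<n. ((s * fst p) ^ k / fact k) *\<^sub>R D k (center p)))
          \<le> C * \<bar>s\<bar> ^ n * fst p ^ n"
      using mesh_size[OF p] by (simp add: abs_mult power_mult_distrib mult.assoc)
  qed
qed

lemma avg_at_antiderivative:
  assumes "\<And>x. (\<beta> has_vector_derivative f x) (at x)" "0 < fst p"
  shows "avg_at f k p = (1 / fst p) *\<^sub>R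
    (\<beta> (center p + (of_int k + 1 / 2) * fst p) - \<beta> (center p + (of_int k - 1 / 2) * fst p))"
proof -
  have "(f has_integral \<beta> (center p + (of_int k + 1 / 2) * fst p) - \<beta> (center p + (of_int k - 1 / 2) * fst p))
      {center p + (of_int k - 1 / 2) * fst p..center p + (of_int k + 1 / 2) * fst p}"
    using assms by (intro fundamental_theorem_of_calculus)
      (auto intro: has_vector_derivative_at_within)
  then show ?thesis
    by (simp add: avg_at_def cell_average_def interface_def center_def cell_center_def
        algebra_simps integral_unique)
qed

text \<open>The antiderivative is expanded to order four at both ends of the cell; dividing the
  difference by the mesh size leaves order three. This order is required for the source, where
  bottom jumps are divided by the mesh size once more.\<close>

lemma avg_at_expansion:
  fixes D :: "nat \<Rightarrow> real \<Rightarrow> 'a::euclidean_space"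
  assumes "\<And>n x. (D n has_vector_derivative D (Suc n) x) (at x)"
  shows "bigo_on (mesh a b) (\<lambda>p. fst p ^ 3)
           (\<lambda>p. avg_at (D 0) k p - D 0 (center p) - (of_int k * fst p) *\<^sub>R D 1 (center p)
                - (((of_int k)\<^sup>2 / 2 + 1 / 24) * (fst p)\<^sup>2) *\<^sub>R D 2 (center p))"
proof -
  obtain \<beta> where \<beta>: "\<And>n x. (case_nat \<beta> D n has_vector_derivative case_nat \<beta> D (Suc n) x) (at x)"
    using derivatives_antiderivative[of D, OF assms] by blast
  define E where "E = (\<lambda>s p. case_nat \<beta> D 0 (center p + s * fst p)
      - (\<Sum>k<4. ((s * fst p) ^ k / fact k) *\<^sub>R case_nat \<beta> D k (center p)))"
  have E: "bigo_on (mesh a b) (\<lambda>p. fst p ^ 4) (E s)" for s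
    unfolding E_def by (rule mesh_taylor[of "case_nat \<beta> D", OF \<beta>])
  define r where "r = real_of_int k"
  obtain C where C: "\<And>p. p \<in> mesh a b \<Longrightarrow> norm (E (r + 1/2) p - E (r - 1/2) p) \<le> C * fst p ^ 4"
    using bigo_onE[OF bigo_on_diff[OF E[of "r + 1/2"] E[of "r - 1/2"]]] by blast
  have eq: "avg_at (D 0) k p - D 0 (center p) - (of_int k * fst p) *\<^sub>R D 1 (center p)
                - (((of_int k)\<^sup>2 / 2 + 1 / 24) * (fst p)\<^sup>2) *\<^sub>R D 2 (center p)
       = (1 / fst p) *\<^sub>R (E (r + 1/2) p - E (r - 1/2) p)" if p: "p \<in> mesh a b" for p
  proof -
    define d where "d = fst p"
    have d: "0 < d" using mesh_size[OF p] by (simp add: d_def)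
    \<comment> \<open>\<open>c j\<close> is the coefficient of the \<open>j\<close>-th derivative of
      \<open>\<beta>\<close> in the difference of the two Taylor polynomials; \<open>c 3\<close>
      produces \<open>k^2 / 2 + 1 / 24\<close>, as
      \<open>((k + 1/2)^3 - (k - 1/2)^3) / 6\<close>.\<close>
    define c where "c = (\<lambda>j. ((r + 1/2) * d) ^ j / fact j - ((r - 1/2) * d) ^ j / fact j)"
    have c: "c 0 = 0" "c 1 = d" "c 2 = d * (r * d)" "c 3 = d * ((r\<^sup>2 / 2 + 1 / 24) * d\<^sup>2)"
      by (simp_all add: c_def fact_numeral power2_eq_square power3_eq_cube field_simps)
    have "E (r + 1/2) p - E (r - 1/2) p =
        \<beta> (center p + (r + 1/2) * d) - \<beta> (center p + (r - 1/2) * d)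
        - (\<Sum>j<4. c j *\<^sub>R case_nat \<beta> D j (center p))"
      unfolding E_def c_def d_def scaleR_diff_left sum_subtractf by simp
    also have "(\<Sum>j<4. c j *\<^sub>R case_nat \<beta> D j (center p)) =
        d *\<^sub>R (D 0 (center p) + (r * d) *\<^sub>R D 1 (center p) + ((r\<^sup>2 / 2 + 1 / 24) * d\<^sup>2) *\<^sub>R D 2 (center p))"
      using c by (simp add: lessThan_nat_numeral lessThan_Suc eval_nat_numeral scaleR_add_right)
    finally have "(1 / d) *\<^sub>R (E (r + 1/2) p - E (r - 1/2) p) =
        (1 / d) *\<^sub>R (\<beta> (center p + (r + 1/2) * d) - \<beta> (center p + (r - 1/2) * d))
        - (D 0 (center p) + (r * d) *\<^sub>R D 1 (center p) + ((r\<^sup>2 / 2 + 1 / 24) * d\<^sup>2) *\<^sub>R D 2 (center p))"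
      using d by (simp add: scaleR_diff_right)
    moreover have "avg_at (D 0) k p =
        (1 / d) *\<^sub>R (\<beta> (center p + (r + 1/2) * d) - \<beta> (center p + (r - 1/2) * d))"
      unfolding d_def r_def using \<beta>[of 0] d by (intro avg_at_antiderivative) (auto simp: d_def)
    ultimately show ?thesis unfolding d_def[symmetric] r_def[symmetric]
      by (simp only: diff_diff_eq add.assoc)
  qed
  show ?thesis
  proof (rule bigo_onI[where C = C])
    fix p assume p: "p \<in> mesh a b"
    have d: "0 < fst p" using mesh_size[OF p] by simp
    have "norm ((1 / fst p) *\<^sub>R (E (r + 1/2) p - E (r - 1/2) p)) \<le> C * fst p ^ 4 / fst p"
      using C[OF p] d by (simp add: divide_right_mono)
    also have "\<dots> = C * fst p ^ 3" using d by (simp add: eval_nat_numeral)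
    finally show "norm (avg_at (D 0) k p - D 0 (center p) - (of_int k * fst p) *\<^sub>R D 1 (center p)
                - (((of_int k)\<^sup>2 / 2 + 1 / 24) * (fst p)\<^sup>2) *\<^sub>R D 2 (center p)) \<le> C * fst p ^ 3"
      unfolding eq[OF p] .
  qed
qed

section \<open>The symmetric trilinear form of a polynomial chaos basis\<close>

lemma height_mk_state [simp]: "height (mk_state h q) = h"
  by (simp add: height_def mk_state_def vec_eq_iff)

lemma discharge_mk_state [simp]: "discharge (mk_state h q) = q"
  by (simp add: discharge_def mk_state_def vec_eq_iff)

lemma bounded_linear_height: "bounded_linear height"
  by (rule linear_conv_bounded_linear[THEN iffD1], rule linearI)
    (simp_all add: height_def vec_eq_iff)

lemma bounded_linear_discharge: "bounded_linear discharge"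
  by (rule linear_conv_bounded_linear[THEN iffD1], rule linearI)
    (simp_all add: discharge_def vec_eq_iff)

lemmas height_simps [simp] = linear_simps[OF bounded_linear_height]
lemmas discharge_simps [simp] = linear_simps[OF bounded_linear_discharge]

lemma mk_state_add: "mk_state a b + mk_state c d = mk_state (a + c) (b + d)"
  by (simp add: mk_state_def vec_eq_iff split: sum.split)

lemma mk_state_diff: "mk_state a b - mk_state c d = mk_state (a - c) (b - d)"
  by (simp add: mk_state_def vec_eq_iff split: sum.split)

lemma mk_state_scaleR: "c *\<^sub>R mk_state a b = mk_state (c *\<^sub>R a) (c *\<^sub>R b)"
  by (simp add: mk_state_def vec_eq_iff split: sum.split)

lemma mk_state_minus: "- mk_state a b = mk_state (- a) (- b)"
  by (simp add: mk_state_def vec_eq_iff split: sum.split)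

lemma mk_state_0 [simp]: "mk_state 0 0 = 0"
  by (simp add: mk_state_def vec_eq_iff split: sum.split)

lemma bounded_linear_mk_state: "bounded_linear (\<lambda>z. mk_state (fst z) (snd z))"
  by (rule linear_conv_bounded_linear[THEN iffD1], rule linearI)
    (simp_all add: mk_state_add mk_state_scaleR)

lemma inner_state: "U \<bullet> W = height U \<bullet> height W + discharge U \<bullet> discharge W"
proof -
  have "(\<Sum>s\<in>UNIV. U $ s * W $ s) = (\<Sum>k\<in>UNIV. U $ Inl k * W $ Inl k) + (\<Sum>k\<in>UNIV. U $ Inr k * W $ Inr k)"
    unfolding UNIV_sum by (subst sum.union_disjoint) (auto simp: sum.reindex)
  then show ?thesis by (simp add: inner_vec_def height_def discharge_def)
qed

lemma bounded_bilinear_matrix_vector: "bounded_bilinear ((*v) :: real ^ 'n::finite ^ 'm::finite \<Rightarrow> _)"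
  by (rule bilinear_conv_bounded_bilinear[THEN iffD1])
    (auto simp: bilinear_def matrix_vector_mult_add_rdistrib scaleR_matrix_vector_assoc
      intro!: linearI)

lemma bounded_linear_transpose: "bounded_linear (transpose :: real ^ 'n::finite ^ 'm::finite \<Rightarrow> _)"
  by (rule linear_conv_bounded_linear[THEN iffD1], rule linearI)
    (simp_all add: transpose_def vec_eq_iff)

lemma norm_state_le: "norm U \<le> norm (height U) + norm (discharge U)"
proof (rule power2_le_imp_le)
  show "(norm U)\<^sup>2 \<le> (norm (height U) + norm (discharge U))\<^sup>2"
    unfolding power2_norm_eq_inner inner_state power2_sum by (simp add: power2_norm_eq_inner)
qed simp

lemma inner_transpose_matrix: "x \<bullet> (A *v y) = (transpose A *v x) \<bullet> (y :: real ^ 'n::finite)"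
  by (metis dot_lmul_matrix vector_transpose_matrix transpose_transpose)

lemma matrix_inv_mult_vector:
  fixes A :: "real ^ 'n::finite ^ 'n"
  assumes "invertible A"
  shows "A *v (matrix_inv A *v x) = x" "matrix_inv A *v (A *v x) = x"
proof -
  have "A ** matrix_inv A = mat 1 \<and> matrix_inv A ** A = mat 1"
    using assms unfolding invertible_def matrix_inv_def by (rule someI_ex)
  then show "A *v (matrix_inv A *v x) = x" "matrix_inv A *v (A *v x) = x"
    by (simp_all add: matrix_vector_mul_assoc)
qed

text \<open>The algebraic properties of \<open>pce_matrix\<close> that the scheme relies on: its entries are the
  coefficients of a symmetric trilinear form.\<close>

locale symmetric_trilinear =
  fixes P :: "real ^ 'k::finite \<Rightarrow> real ^ 'k ^ 'k"
  assumes linear: "linear P"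
    and commute: "P a *v b = P b *v a"
    and transpose_P: "transpose (P a) = P a"
begin

lemma bounded_bilinear: "bounded_bilinear (\<lambda>a b. P a *v b)"
proof (rule bilinear_conv_bounded_bilinear[THEN iffD1])
  have "linear (\<lambda>a. P a *v b)" for b
    using matrix_vector_mul_linear[of "P b"] commute[of b] by simp
  then show "bilinear (\<lambda>a b. P a *v b)" by (simp add: bilinear_def)
qed

sublocale B: bounded_bilinear "\<lambda>a b. P a *v b" by (rule bounded_bilinear)

lemma inner_P: "(P a *v b) \<bullet> c = b \<bullet> (P a *v c)"
  by (simp add: inner_transpose_matrix transpose_P)

text \<open>These two transpositions generate all permutations of the arguments of the trilinear
  form \<open>a \<bullet> (P b *v c)\<close>.\<close>

lemma inner_P': "a \<bullet> (P b *v c) = b \<bullet> (P a *v c)" "a \<bullet> (P b *v c) = a \<bullet> (P c *v b)"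
  using inner_P[of c a b] commute[of b c] commute[of a c] by (simp_all add: inner_commute)

section \<open>Coercivity: positive definiteness with an explicit constant\<close>

definition coercive :: "real \<Rightarrow> real ^ 'k \<Rightarrow> bool" where
  "coercive c h \<longleftrightarrow> (\<forall>v. c * (v \<bullet> v) \<le> v \<bullet> (P h *v v))"

text \<open>Cauchy-Schwarz bounds the quadratic form from above by
  \<open>norm v * norm (P h *v v)\<close>. The result is a bound on the inverse of
  \<open>P h\<close> that depends on \<open>c\<close> alone.\<close>

lemma coercive_bound:
  assumes "coercive c h" "0 < c"
  shows "norm v \<le> norm (P h *v v) / c"
proof (cases "v = 0")
  case False
  have "c * (norm v * norm v) \<le> v \<bullet> (P h *v v)"
    using assms by (simp add: coercive_def power2_norm_eq_inner[symmetric] power2_eq_square[symmetric])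
  also have "\<dots> \<le> norm v * norm (P h *v v)" by (rule norm_cauchy_schwarz)
  finally have "c * norm v \<le> norm (P h *v v)" using False by (simp add: mult.left_commute)
  then show ?thesis using assms(2) by (simp add: field_simps)
qed simp

lemma coercive_pos_def: "coercive c h \<Longrightarrow> 0 < c \<Longrightarrow> pos_def (P h)"
  unfolding coercive_def pos_def_def transpose_P
  by (metis inner_gt_zero_iff mult_pos_pos order.strict_trans2)

lemma coercive_mono: "coercive c h \<Longrightarrow> c' \<le> c \<Longrightarrow> coercive c' h"
  unfolding coercive_def by (meson inner_ge_zero mult_right_mono order_trans)

lemma coercive_average:
  assumes "coercive c h" "coercive c h'"
  shows "coercive c ((1 / 2) *\<^sub>R (h + h'))"
  unfolding coercive_def
proof
  fix v
  show "c * (v \<bullet> v) \<le> v \<bullet> (P ((1 / 2) *\<^sub>R (h + h')) *v v)"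
    using assms[unfolded coercive_def, rule_format, of v]
    by (simp add: B.scaleR_left B.add_left inner_add_right)
qed

lemma pos_def_average:
  assumes "pos_def (P h)" "pos_def (P h')"
  shows "pos_def (P ((1 / 2) *\<^sub>R (h + h')))"
  using assms unfolding pos_def_def
  by (auto simp: transpose_P B.scaleR_left B.add_left inner_add_right add_pos_pos)

lemma pos_def_invertible:
  assumes "pos_def (P h)"
  shows "invertible (P h)"
proof -
  have "inj ((*v) (P h))"
  proof (rule injI)
    fix x y assume eq: "P h *v x = P h *v y"
    then have "(x - y) \<bullet> (P h *v (x - y)) = 0" by (simp add: B.diff_right)
    then show "x = y" using assms unfolding pos_def_def by (metis less_irrefl right_minus_eq)
  qed
  then show ?thesis
    by (simp add: invertible_left_inverse matrix_left_invertible_injective)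
qed

text \<open>The quadratic form is continuous on the compact product of \<open>X\<close> with the
  unit sphere, so it attains a minimum there, which is positive; scaling extends the bound to all
  vectors.\<close>

lemma coercive_compact:
  assumes "compact X" "continuous_on X h" "\<And>x. x \<in> X \<Longrightarrow> pos_def (P (h x))"
  obtains c where "0 < c" "\<And>x. x \<in> X \<Longrightarrow> coercive c (h x)"
proof (cases "X = {}")
  case False
  let ?S = "X \<times> sphere (0 :: real ^ 'k) 1"
  let ?f = "\<lambda>z. snd z \<bullet> (P (h (fst z)) *v snd z)"
  have "compact ?S" using assms(1) by (intro compact_Times) auto
  moreover have "?S \<noteq> {}" using False by auto
  moreover have "continuous_on ?S ?f"
    by (intro continuous_intros B.continuous_on continuous_on_compose2[OF assms(2)]) auto
  ultimately obtain z where z: "z \<in> ?S" "\<And>w. w \<in> ?S \<Longrightarrow> ?f z \<le> ?f w"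
    using continuous_attains_inf[of ?S ?f] by blast
  have "0 < ?f z" using z(1) assms(3)[of "fst z"] unfolding pos_def_def
    by (metis mem_Times_iff mem_sphere_0 norm_zero zero_neq_one)
  moreover have "coercive (?f z) (h x)" if x: "x \<in> X" for x
    unfolding coercive_def
  proof
    fix v :: "real ^ 'k"
    show "?f z * (v \<bullet> v) \<le> v \<bullet> (P (h x) *v v)"
    proof (cases "v = 0")
      case False
      define w where "w = (1 / norm v) *\<^sub>R v"
      have "?f z \<le> w \<bullet> (P (h x) *v w)"
        using z(2)[of "(x, w)"] x False by (simp add: w_def)
      also have "\<dots> = (v \<bullet> (P (h x) *v v)) / (v \<bullet> v)"
        by (simp add: w_def B.scaleR_right dot_square_norm power2_eq_square)
      finally show ?thesis using False by (simp add: field_simps)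
    qed simp
  qed
  ultimately show thesis by (rule that)
\<comment> \<open>For empty \<open>X\<close> any positive constant will do.\<close>
qed (use that[of 1] in auto)

lemma coercive_of_pos_def:
  assumes "pos_def (P h)"
  obtains c where "0 < c" "coercive c h"
  using coercive_compact[of "{0 :: real}" "\<lambda>_. h"] assms by auto

section \<open>The velocity as a differentiable function of the state\<close>

lemma P_velocity:
  assumes "pos_def (P (height U))"
  shows "P (height U) *v velocity P U = discharge U"
  unfolding velocity_def by (rule matrix_inv_mult_vector(1)[OF pos_def_invertible[OF assms]])

lemma velocity_unique:
  assumes "pos_def (P (height U))" "P (height U) *v u = discharge U"
  shows "velocity P U = u"
  unfolding velocity_def assms(2)[symmetric]
  by (rule matrix_inv_mult_vector(2)[OF pos_def_invertible[OF assms(1)]])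

text \<open>Changing \<open>h\<close> to \<open>h'\<close> changes the quadratic form by at most
  \<open>K * norm (h' - h)\<close> times \<open>v \<bullet> v\<close>; a distance below
  \<open>c / (2 * K)\<close> uses up at most half of \<open>c\<close>.\<close>

lemma coercive_near:
  assumes "0 < c" "coercive c h"
  obtains \<epsilon> where "0 < \<epsilon>" "\<And>h'. norm (h' - h) < \<epsilon> \<Longrightarrow> coercive (c / 2) h'"
proof -
  obtain K where K: "0 < K" "\<And>a b. norm (P a *v b) \<le> norm a * norm b * K"
    using B.pos_bounded by blast
  have "coercive (c / 2) h'" if h': "norm (h' - h) < c / (2 * K)" for h'
    unfolding coercive_def
  proof
    fix v
    have "\<bar>v \<bullet> (P (h' - h) *v v)\<bar> \<le> norm v * (norm (h' - h) * norm v * K)"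
      using Cauchy_Schwarz_ineq2[of v "P (h' - h) *v v"] K(2)[of "h' - h" v]
      by (meson mult_left_mono norm_ge_zero order_trans)
    also have "\<dots> = norm (h' - h) * K * (v \<bullet> v)"
      by (simp add: dot_square_norm power2_eq_square)
    also have "\<dots> \<le> c / 2 * (v \<bullet> v)"
      using h' K(1) by (intro mult_right_mono) (auto simp: field_simps)
    finally have "v \<bullet> (P h *v v) - v \<bullet> (P h' *v v) \<le> c / 2 * (v \<bullet> v)"
      unfolding B.diff_left inner_diff_right by linarith
    then show "c / 2 * (v \<bullet> v) \<le> v \<bullet> (P h' *v v)"
      using assms(2)[unfolded coercive_def, rule_format, of v] by linarith
  qed
  moreover have "0 < c / (2 * K)" using assms K by simp
  ultimately show thesis using that by blast
qed

text \<open>Found by differentiating \<open>P h *v u = q\<close> in direction \<open>W\<close> and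
  solving for the derivative of \<open>u\<close>.\<close>

definition velocity_deriv :: "'k state \<Rightarrow> 'k state \<Rightarrow> real ^ 'k" where
  "velocity_deriv U W =
     matrix_inv (P (height U)) *v (discharge W - P (height W) *v velocity P U)"

lemma bounded_linear_velocity_deriv: "bounded_linear (velocity_deriv U)"
  unfolding velocity_deriv_def
  by (intro bounded_linear_compose[OF matrix_vector_mul_bounded_linear] bounded_linear_sub
      bounded_linear_discharge bounded_linear_compose[OF B.bounded_linear_left bounded_linear_height])

lemma P_velocity_deriv:
  assumes "pos_def (P (height U))"
  shows "P (height U) *v velocity_deriv U W = discharge W - P (height W) *v velocity P U"
  unfolding velocity_deriv_def by (rule matrix_inv_mult_vector(1)[OF pos_def_invertible[OF assms]])

text \<open>Only the equation \<open>P h *v u = q\<close> is differentiated, never the matrix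
  inverse. Coercivity near \<open>U\<close> first gives a Lipschitz bound for the velocity, and then
  the linearization error solves an equation with quadratically small right-hand side.\<close>

lemma velocity_has_derivative:
  assumes "pos_def (P (height U))"
  shows "(velocity P has_derivative velocity_deriv U) (at U within S)"
proof -
  obtain c where c: "0 < c" "coercive c (height U)" using coercive_of_pos_def[OF assms] by blast
  obtain \<epsilon> where e: "0 < \<epsilon>" "\<And>h'. norm (h' - height U) < \<epsilon> \<Longrightarrow> coercive (c / 2) h'"
    using coercive_near[OF c] by blast
  obtain Kh where Kh: "0 < Kh" "\<And>W :: 'k state. norm (height W) \<le> norm W * Kh"
    using bounded_linear.pos_bounded[OF bounded_linear_height] by blast
  obtain Kd where Kd: "0 < Kd" "\<And>W :: 'k state. norm (discharge W) \<le> norm W * Kd"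
    using bounded_linear.pos_bounded[OF bounded_linear_discharge] by blast
  obtain K where K: "0 < K" "\<And>a b. norm (P a *v b) \<le> norm a * norm b * K"
    using B.pos_bounded by blast
  define u where "u = velocity P U"
  define A where "A = (Kd + Kh * norm u * K) / (c / 2)"
  define C where "C = Kh * A * K / c"
  have A: "0 \<le> A" using Kd Kh K c by (simp add: A_def)
  have main: "norm (velocity P W - u - velocity_deriv U (W - U)) \<le> C * norm (W - U) * norm (W - U)"
    if W: "dist W U < \<epsilon> / Kh" for W
  proof -
    have hW: "norm (height W - height U) \<le> norm (W - U) * Kh" using Kh(2)[of "W - U"] by simp
    have "norm (height W - height U) < \<epsilon>"
      using hW W Kh(1) by (simp add: dist_norm field_simps)
    then have cW: "coercive (c / 2) (height W)" by (rule e(2))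
    then have pW: "pos_def (P (height W))" using c(1) coercive_pos_def[of "c / 2"] by simp
    \<comment> \<open>Difference of the equations at \<open>W\<close> and \<open>U\<close>, with the
      matrix at \<open>W\<close> kept on the left; its coercivity constant is
      \<open>c / 2\<close>.\<close>
    have "P (height W) *v (velocity P W - u) = discharge W - discharge U - P (height W - height U) *v u"
      using P_velocity[OF pW] P_velocity[OF assms] by (simp add: B.diff_right B.diff_left u_def)
    then have "norm (P (height W) *v (velocity P W - u))
        \<le> norm (discharge (W - U)) + norm (P (height (W - U)) *v u)"
      using norm_triangle_ineq4 by simp
    also have "\<dots> \<le> norm (W - U) * Kd + norm (W - U) * Kh * norm u * K"
      by (intro add_mono Kd(2) order_trans[OF K(2)] mult_right_mono Kh(2)
          norm_ge_zero less_imp_le[OF K(1)])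
    finally have "norm (P (height W) *v (velocity P W - u)) \<le> norm (W - U) * (Kd + Kh * norm u * K)"
      by (simp add: algebra_simps)
    then have "norm (P (height W) *v (velocity P W - u)) / (c / 2)
        \<le> norm (W - U) * (Kd + Kh * norm u * K) / (c / 2)"
      using c(1) by (intro divide_right_mono) auto
    also have "\<dots> = A * norm (W - U)" by (simp add: A_def)
    finally have "norm (P (height W) *v (velocity P W - u)) / (c / 2) \<le> A * norm (W - U)" .
    moreover have "norm (velocity P W - u) \<le> norm (P (height W) *v (velocity P W - u)) / (c / 2)"
      using c(1) by (intro coercive_bound[OF cW]) simp
    ultimately have 1: "norm (velocity P W - u) \<le> A * norm (W - U)" by linarith
    \<comment> \<open>Now the matrix at \<open>U\<close> stands on the left, and what remains is a
      product of two first-order differences.\<close>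
    have "P (height U) *v (velocity P W - u - velocity_deriv U (W - U))
        = - (P (height W - height U) *v (velocity P W - u))"
      using P_velocity[OF pW] P_velocity[OF assms] P_velocity_deriv[OF assms, of "W - U"]
      by (simp add: B.diff_right B.diff_left u_def)
    then have "norm (velocity P W - u - velocity_deriv U (W - U))
        \<le> norm (P (height W - height U) *v (velocity P W - u)) / c"
      using coercive_bound[OF c(2,1)] by (metis norm_minus_cancel)
    also have "\<dots> \<le> (norm (W - U) * Kh) * (A * norm (W - U)) * K / c"
      using K(1) Kh(1) c(1)
      by (intro divide_right_mono order_trans[OF K(2)] mult_right_mono mult_mono[OF hW 1]) auto
    finally show ?thesis by (simp add: C_def mult_ac)
  qed
  show ?thesis
  proof (rule has_derivativeI_sandwich)
    show "0 < \<epsilon> / Kh" using e Kh by simp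
    show "bounded_linear (velocity_deriv U)" by (rule bounded_linear_velocity_deriv)
    show "norm (velocity P W - velocity P U - velocity_deriv U (W - U)) / norm (W - U) \<le> C * norm (W - U)"
      if "W \<noteq> U" "dist W U < \<epsilon> / Kh" for W
      using main[OF that(2)] that(1) by (simp add: u_def field_simps)
    have "((\<lambda>W. C * norm (W - U)) \<longlongrightarrow> C * norm (U - U)) (at U within S)"
      by (intro tendsto_intros)
    then show "((\<lambda>W. C * norm (W - U)) \<longlongrightarrow> 0) (at U within S)" by simp
  qed
qed

end

section \<open>Limited reconstruction and the energy balance\<close>

lemma minmod_range: "0 \<le> minmod \<theta>" "minmod \<theta> \<le> 1"
  by (simp_all add: minmod_def)

text \<open>\<open>minmod (y / x) * x\<close> is the projection of \<open>y\<close> onto the segment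
  from \<open>0\<close> to \<open>x\<close>. Projection does not increase distances and fixes
  \<open>x\<close>. For \<open>x = 0\<close> the segment is a point and the product
  vanishes.\<close>

lemma minmod_slope_bound: "\<bar>x - minmod (y / x) * x\<bar> \<le> \<bar>x - y\<bar>"
proof (cases "x = 0")
  case False
  consider "y / x < 0" | "0 \<le> y / x" "y / x \<le> 1" | "1 < y / x" by linarith
  then show ?thesis
  proof cases
    case 1
    then have "x < 0 \<and> 0 < y \<or> 0 < x \<and> y < 0" by (auto simp: divide_less_0_iff)
    then show ?thesis using 1 by (auto simp: minmod_def)
  qed (use False in \<open>auto simp: minmod_def\<close>)
qed simp

text \<open>The traces on both sides of interface \<open>i\<close> are scaled by the same matrix
  \<open>R i\<close>.\<close>

lemma scaled_jump_eq: "scaled_jump R V i = transpose (R i) *v jump V i"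
  by (simp add: scaled_jump_def trace_jump_def scaled_minus_def scaled_plus_def jump_def
      matrix_vector_mult_diff_distrib)

definition rec_scaled_jump ::
    "(int \<Rightarrow> real ^ 'n ^ 'n) \<Rightarrow> (int \<Rightarrow> real ^ 'n::finite) \<Rightarrow> int \<Rightarrow> real ^ 'n" where
  "rec_scaled_jump R V = trace_jump (rec_scaled_minus R V) (rec_scaled_plus R V)"

text \<open>The reconstructed jump is the mean of two terms, the scaled jump limited against its
  right and against its left neighbour. Sign and size are estimated for each of them
  separately.\<close>

lemma rec_scaled_jump_component:
  "rec_scaled_jump R V i $ k =
     (1 / 2) * ((scaled_jump R V i $ k
         - minmod (scaled_jump R V (i + 1) $ k / scaled_jump R V i $ k) * scaled_jump R V i $ k)
       + (scaled_jump R V i $ k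
         - minmod (scaled_jump R V (i - 1) $ k / scaled_jump R V i $ k) * scaled_jump R V i $ k))"
proof -
  have "scaled_minus R V (i + 1) $ k - scaled_plus R V i $ k = scaled_jump R V i $ k"
    by (simp add: scaled_jump_def trace_jump_def)
  then show ?thesis
    by (simp add: rec_scaled_jump_def trace_jump_def rec_scaled_minus_def rec_scaled_plus_def
        limited_slope_def field_simps)
qed

text \<open>The sign property of the minmod limiter, which makes the diffusion dissipate energy.\<close>

lemma rec_scaled_jump_sign: "0 \<le> scaled_jump R V i $ k * rec_scaled_jump R V i $ k"
proof -
  define w where "w = scaled_jump R V i $ k"
  have sgn: "0 \<le> w * (w - minmod \<theta> * w)" for \<theta>
  proof -
    have "w * (w - minmod \<theta> * w) = (1 - minmod \<theta>) * (w * w)" by (simp add: algebra_simps)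
    also have "\<dots> \<ge> 0" using minmod_range(2)[of \<theta>] by simp
    finally show ?thesis .
  qed
  have "w * ((1 / 2) * (x + y)) = (1 / 2) * (w * x + w * y)" for x y :: real
    by (simp add: distrib_left)
  then show ?thesis
    unfolding rec_scaled_jump_component w_def[symmetric]
    by (simp only:) (intro mult_nonneg_nonneg add_nonneg_nonneg sgn, simp)
qed

text \<open>The accuracy of the limiter: \<open>minmod_slope_bound\<close> makes the reconstructed
  jump as small as the variation of the scaled jumps between neighbouring interfaces. The factor
  \<open>CARD('n)\<close> comes from estimating the norm by the sum of the components.\<close>

lemma rec_scaled_jump_bound:
  "norm (rec_scaled_jump R V i) \<le> real CARD('n) *
     (norm (scaled_jump R V (i + 1) - scaled_jump R V i)
      + norm (scaled_jump R V i - scaled_jump R V (i - 1)))"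
  for R :: "int \<Rightarrow> real ^ 'n ^ 'n::finite"
proof -
  let ?w = "scaled_jump R V"
  have "\<bar>rec_scaled_jump R V i $ k\<bar> \<le> norm (?w (i + 1) - ?w i) + norm (?w i - ?w (i - 1))" for k
  proof -
    have "\<bar>rec_scaled_jump R V i $ k\<bar> \<le> (1 / 2) * (\<bar>?w i $ k - ?w (i + 1) $ k\<bar> + \<bar>?w i $ k - ?w (i - 1) $ k\<bar>)"
      unfolding rec_scaled_jump_component abs_mult
      by (intro mult_mono order_trans[OF abs_triangle_ineq] add_mono minmod_slope_bound) auto
    moreover have "\<bar>?w i $ k - ?w (i + 1) $ k\<bar> \<le> norm (?w (i + 1) - ?w i)"
      "\<bar>?w i $ k - ?w (i - 1) $ k\<bar> \<le> norm (?w i - ?w (i - 1))"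
      using component_le_norm_cart[of "?w (i + 1) - ?w i" k]
        component_le_norm_cart[of "?w i - ?w (i - 1)" k] by (simp_all add: abs_minus_commute)
    moreover have "(1 / 2) * (s + t) \<le> s' + t'" if "0 \<le> s" "s \<le> s'" "0 \<le> t" "t \<le> t'"
      for s t s' t' :: real using that by simp
    ultimately show ?thesis by (blast intro: order_trans abs_ge_zero)
  qed
  then have "(\<Sum>k\<in>UNIV. \<bar>rec_scaled_jump R V i $ k\<bar>) \<le> real CARD('n) *
     (norm (?w (i + 1) - ?w i) + norm (?w i - ?w (i - 1)))"
    using sum_bounded_above[of UNIV "\<lambda>k. \<bar>rec_scaled_jump R V i $ k\<bar>"] by simp
  then show ?thesis using norm_le_l1_cart order_trans by blast
qed

lemma rec_jump_scaled:
  assumes "invertible (R i)"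
  shows "transpose (R i) *v trace_jump (rec_minus R V) (rec_plus R V) i = rec_scaled_jump R V i"
  using matrix_inv_mult_vector(1)[OF transpose_invertible[OF assms]]
  by (simp add: trace_jump_def rec_minus_def rec_plus_def rec_scaled_jump_def
      matrix_vector_mult_diff_distrib)

section \<open>The diffusion term in scaled variables\<close>

lemma diagonal_vector:
  assumes "diagonal A"
  shows "(A *v x) $ k = A $ k $ k * x $ k"
proof -
  have "(\<Sum>j\<in>UNIV. A $ k $ j * x $ j) = (\<Sum>j\<in>UNIV. if j = k then A $ k $ k * x $ k else 0)"
    using assms by (intro sum.cong) (auto simp: diagonal_def)
  then show ?thesis by (simp add: matrix_vector_mult_def)
qed

lemma abs_diagonal_vector:
  assumes "diagonal A"
  shows "(abs_entries A *v x) $ k = \<bar>A $ k $ k\<bar> * x $ k"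
proof -
  have "diagonal (abs_entries A)" using assms by (simp add: diagonal_def abs_entries_def)
  from diagonal_vector[OF this] show ?thesis by (simp add: abs_entries_def)
qed

lemma diffusion_rec_jump:
  assumes "invertible (R i)"
  shows "(R i ** A ** transpose (R i)) *v trace_jump (rec_minus R V) (rec_plus R V) i =
    R i *v (A *v rec_scaled_jump R V i)"
  using rec_jump_scaled[of R i V, OF assms] by (simp add: matrix_vector_mul_assoc[symmetric])

lemma diffusion_nonneg:
  assumes "invertible (R i)" "diagonal A"
  shows "0 \<le> jump V i \<bullet>
    ((R i ** abs_entries A ** transpose (R i)) *v trace_jump (rec_minus R V) (rec_plus R V) i)"
proof -
  \<comment> \<open>Moving \<open>R i\<close> to the other factor turns the jump of \<open>V\<close>
    into the scaled jump, so that the diagonal matrix acts componentwise.\<close>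
  have "jump V i \<bullet> (R i *v (abs_entries A *v rec_scaled_jump R V i)) =
      (\<Sum>k\<in>UNIV. \<bar>A $ k $ k\<bar> * (scaled_jump R V i $ k * rec_scaled_jump R V i $ k))"
    unfolding inner_transpose_matrix[of _ "R i"] scaled_jump_eq[symmetric]
    by (simp add: inner_vec_def abs_diagonal_vector[OF assms(2)] mult_ac)
  then show ?thesis
    unfolding diffusion_rec_jump[of R i, OF assms(1)]
    by (simp add: sum_nonneg rec_scaled_jump_sign)
qed

context symmetric_trilinear begin

lemma pos_def_roe_state:
  assumes "pos_def (P (height (U i)))" "pos_def (P (height (U (i + 1))))"
  shows "pos_def (P (height (roe_state P U i)))"
  using pos_def_average[OF assms] by (simp add: roe_state_def avg_def Let_def)

text \<open>The entropy variable is the gradient of the energy with respect to the state, for fixed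
  bottom value.\<close>

lemma energy_has_derivative:
  assumes "pos_def (P (height (U t)))" and U: "(U has_vector_derivative W) (at t within J)"
  shows "((\<lambda>s. energy P g (U s) b) has_real_derivative entropy_var P g (U t) b \<bullet> W) (at t within J)"
proof -
  define u where "u = velocity P (U t)"
  define u' where "u' = velocity_deriv (U t) W"
  define h where "h = height (U t)"
  define q where "q = discharge (U t)"
  have du: "((\<lambda>s. velocity P (U s)) has_vector_derivative u') (at t within J)"
    using vector_derivative_diff_chain_within[OF U velocity_has_derivative[OF assms(1)]]
    by (simp add: u'_def o_def)
  have dh: "((\<lambda>s. height (U s)) has_vector_derivative height W) (at t within J)"
    by (rule bounded_linear.has_vector_derivative[OF bounded_linear_height U])
  have dq: "((\<lambda>s. discharge (U s)) has_vector_derivative discharge W) (at t within J)"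
    by (rule bounded_linear.has_vector_derivative[OF bounded_linear_discharge U])
  note ip = bounded_bilinear.has_vector_derivative[OF bounded_bilinear_inner]
  have "((\<lambda>s. energy P g (U s) b) has_vector_derivative
      (1 / 2) * ((q \<bullet> u' + discharge W \<bullet> u) + g * (h \<bullet> height W + height W \<bullet> h))
       + g * (h \<bullet> 0 + height W \<bullet> b)) (at t within J)"
    unfolding energy_def power2_norm_eq_inner u_def h_def q_def
    by (intro has_vector_derivative_add has_vector_derivative_mult_right
        ip[OF dq du] ip[OF dh dh] ip[OF dh has_vector_derivative_const])
  moreover have "(1 / 2) * ((q \<bullet> u' + discharge W \<bullet> u) + g * (h \<bullet> height W + height W \<bullet> h))
       + g * (h \<bullet> 0 + height W \<bullet> b) = entropy_var P g (U t) b \<bullet> W"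
  proof -
    \<comment> \<open>Symmetry of \<open>P h\<close> moves it from \<open>u\<close> to
      \<open>u'\<close>, where the equation for the derivative of the velocity applies.\<close>
    have "q \<bullet> u' = u \<bullet> discharge W - height W \<bullet> (P u *v u)"
    proof -
      have "q \<bullet> u' = u \<bullet> (P h *v u')"
        using P_velocity[OF assms(1)] inner_P[of h u u'] by (simp add: q_def h_def u_def)
      also have "P h *v u' = discharge W - P (height W) *v u"
        using P_velocity_deriv[OF assms(1)] by (simp add: h_def u'_def u_def)
      finally show ?thesis by (simp add: inner_diff_right inner_P'(1)[of u])
    qed
    moreover have "entropy_var P g (U t) b \<bullet> W =
        - (1 / 2) * (height W \<bullet> (P u *v u)) + g * (height W \<bullet> h) + g * (height W \<bullet> b) + u \<bullet> discharge W"
      by (simp add: entropy_var_def Let_def inner_state u_def[symmetric] h_def[symmetric]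
          inner_diff_left inner_add_left inner_diff_right inner_add_right inner_commute algebra_simps)
    ultimately show ?thesis by (simp add: inner_commute algebra_simps)
  qed
  ultimately show ?thesis
    by (simp only: has_real_derivative_iff_has_vector_derivative)
qed

text \<open>At states with positive definite \<open>P h\<close> this is
  \<open>entropy_var \<bullet> sg_flux - energy_flux\<close>; the bottom terms cancel in that
  difference.\<close>

definition entropy_potential :: "real \<Rightarrow> 'k state \<Rightarrow> real" where
  "entropy_potential g U = (g / 2) * (velocity P U \<bullet> (P (height U) *v height U))"

text \<open>The discrete Tadmor condition that characterizes energy conservative fluxes.\<close>

lemma ec_flux_entropy:
  "jump (\<lambda>j. entropy_var P g (U j) (B j)) i \<bullet> ec_flux P g U i
     - g * (avg (\<lambda>j. velocity P (U j)) i \<bullet> (P (avg (\<lambda>j. height (U j)) i) *v jump B i))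
   = jump (\<lambda>j. entropy_potential g (U j)) i"
proof -
  define h0 h1 where h: "h0 = height (U i)" "h1 = height (U (i + 1))"
  define u0 u1 where u: "u0 = velocity P (U i)" "u1 = velocity P (U (i + 1))"
  define b where "b = jump B i"
  define hm where "hm = (1 / 2) *\<^sub>R (h0 + h1)"
  define um where "um = (1 / 2) *\<^sub>R (u0 + u1)"
  define z where "z = P hm *v um"
  have V: "jump (\<lambda>j. entropy_var P g (U j) (B j)) i =
      mk_state (- (1 / 2) *\<^sub>R (P u1 *v u1 - P u0 *v u0) + g *\<^sub>R (h1 - h0) + g *\<^sub>R b) (u1 - u0)"
    by (simp add: jump_def entropy_var_def Let_def mk_state_diff h u b_def algebra_simps)
  have F: "ec_flux P g U i = mk_state z ((g / 4) *\<^sub>R (P h0 *v h0 + P h1 *v h1) + P um *v z)"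
    by (simp add: ec_flux_def avg_def Let_def h u hm_def um_def z_def)
  \<comment> \<open>Difference of squares for the symmetric product. It makes the kinetic part of
    the momentum flux cancel against the kinetic part of the height entropy variable.\<close>
  have "P u1 *v u1 - P u0 *v u0 = 2 *\<^sub>R (P um *v (u1 - u0))"
    using commute[of u0 u1]
    by (simp add: um_def B.add_left B.scaleR_left B.diff_right algebra_simps)
  then have q: "(P u1 *v u1 - P u0 *v u0) \<bullet> z = 2 * ((u1 - u0) \<bullet> (P um *v z))"
    by (simp add: inner_P)
  have b: "b \<bullet> z = um \<bullet> (P hm *v b)"
    by (simp add: z_def inner_P'(1)[of b] inner_P'(2)[of hm] inner_P'(1)[of um])
  have t: "h1 \<bullet> (P h1 *v x) = x \<bullet> (P h1 *v h1)" "h0 \<bullet> (P h0 *v x) = x \<bullet> (P h0 *v h0)"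
    "h1 \<bullet> (P h0 *v x) = h0 \<bullet> (P h1 *v x)" for x
    using inner_P'(1)[of h1 h0] inner_P'[of x h1 h1] inner_P'[of x h0 h0]
      inner_P'(2)[of h1 h1 x] inner_P'(2)[of h0 h0 x]
      inner_P'(1)[of h1 x h1] inner_P'(1)[of h0 x h0] by simp_all
  \<comment> \<open>Again a difference of squares,
    \<open>P h1 *v h1 - P h0 *v h0 = 2 *\<^sub>R (P hm *v (h1 - h0))\<close>, read inside the
    trilinear form.\<close>
  have l: "(h1 - h0) \<bullet> z = (1 / 2) * (um \<bullet> (P h1 *v h1) - um \<bullet> (P h0 *v h0))"
    by (simp add: z_def hm_def B.add_left B.scaleR_left inner_diff_left inner_add_right t
        algebra_simps)
  have "jump (\<lambda>j. entropy_var P g (U j) (B j)) i \<bullet> ec_flux P g U i - g * (um \<bullet> (P hm *v b)) =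
      - (1 / 2) * ((P u1 *v u1 - P u0 *v u0) \<bullet> z) + g * ((h1 - h0) \<bullet> z) + g * (b \<bullet> z)
      + (g / 4) * ((u1 - u0) \<bullet> (P h0 *v h0 + P h1 *v h1)) + (u1 - u0) \<bullet> (P um *v z)
      - g * (um \<bullet> (P hm *v b))"
    by (simp only: V F inner_state height_mk_state discharge_mk_state inner_add_left inner_add_right
        inner_scaleR_left inner_scaleR_right add.assoc)
  also have "\<dots> = g * ((h1 - h0) \<bullet> z) + (g / 4) * ((u1 - u0) \<bullet> (P h0 *v h0 + P h1 *v h1))"
    unfolding q b by simp
  \<comment> \<open>Discrete product rule: mean times jump plus jump times mean is the jump of the
    product.\<close>
  also have "\<dots> = (g / 2) * (u1 \<bullet> (P h1 *v h1) - u0 \<bullet> (P h0 *v h0))"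
    unfolding l um_def
    by (simp add: inner_diff_left inner_add_left inner_add_right algebra_simps)
  also have "\<dots> = jump (\<lambda>j. entropy_potential g (U j)) i"
    by (simp add: jump_def entropy_potential_def h u right_diff_distrib)
  finally show ?thesis by (simp add: avg_def b_def hm_def um_def h u)
qed

end

section \<open>Energy stability and well-balancedness\<close>

text \<open>A mesh function through given values in the cells \<open>-1\<close>, \<open>0\<close>, \<open>1\<close>, \<open>2\<close>, which form the
  stencil of interface \<open>0\<close>.\<close>

definition stencil :: "'a \<Rightarrow> 'a \<Rightarrow> 'a \<Rightarrow> 'a \<Rightarrow> int \<Rightarrow> 'a" where
  "stencil a b c d j = (if j < 0 then a else if j = 0 then b else if j = 1 then c else d)"

lemma roe_state_cong:
  "U i = U' j \<Longrightarrow> U (i + 1) = U' (j + 1) \<Longrightarrow> roe_state P U i = roe_state P U' j"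
  by (simp add: roe_state_def avg_def)

lemma ec_flux_cong:
  "U i = U' j \<Longrightarrow> U (i + 1) = U' (j + 1) \<Longrightarrow> ec_flux P g U i = ec_flux P g U' j"
  by (simp add: ec_flux_def avg_def)

lemma rec_jump_cong:
  assumes R: "R i = R' j" "R (i - 1) = R' (j - 1)" "R (i + 1) = R' (j + 1)"
    and V: "V i = V' j" "V (i - 1) = V' (j - 1)" "V (i + 1) = V' (j + 1)" "V (i + 2) = V' (j + 2)"
  shows "trace_jump (rec_minus R V) (rec_plus R V) i = trace_jump (rec_minus R' V') (rec_plus R' V') j"
proof -
  have e: "i + 1 + 1 = i + 2" "j + 1 + 1 = j + 2" for i j :: int by simp_all
  have w: "scaled_jump R V i = scaled_jump R' V' j"
    "scaled_jump R V (i - 1) = scaled_jump R' V' (j - 1)"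
    "scaled_jump R V (i + 1) = scaled_jump R' V' (j + 1)"
    by (simp_all only: scaled_jump_eq jump_def R V e diff_add_cancel)
  show ?thesis
    by (simp only: trace_jump_def rec_minus_def rec_plus_def rec_scaled_minus_def
        rec_scaled_plus_def scaled_minus_def scaled_plus_def add_diff_cancel_right' R V w)
qed

text \<open>Translation to interface \<open>0\<close> makes the flux a fixed function of eight
  arguments, as the numerical entropy flux in \<open>energy_stable\<close> has to be.\<close>

lemma es2_flux_stencil:
  "es2_flux P g T L U B i =
     es2_flux P g T L (stencil (U (i - 1)) (U i) (U (i + 1)) (U (i + 2)))
       (stencil (B (i - 1)) (B i) (B (i + 1)) (B (i + 2))) 0"
proof -
  let ?U = "stencil (U (i - 1)) (U i) (U (i + 1)) (U (i + 2))"
  let ?B = "stencil (B (i - 1)) (B i) (B (i + 1)) (B (i + 2))"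
  \<comment> \<open>The reconstruction at interface \<open>i\<close> involves the matrices at
    \<open>i - 1\<close>, \<open>i\<close> and \<open>i + 1\<close>, hence three Roe states; the
    last one reaches cell \<open>i + 2\<close>.\<close>
  have "i + 1 + 1 = i + 2" "(0 :: int) + 1 + 1 = 0 + 2" by simp_all
  then have roe: "roe_state P U i = roe_state P ?U 0"
    "roe_state P U (i - 1) = roe_state P ?U (0 - 1)"
    "roe_state P U (i + 1) = roe_state P ?U (0 + 1)"
    by (intro roe_state_cong; simp add: stencil_def add_ac)+
  have "trace_jump (rec_minus (\<lambda>j. T (roe_state P U j)) (\<lambda>j. entropy_var P g (U j) (B j)))
        (rec_plus (\<lambda>j. T (roe_state P U j)) (\<lambda>j. entropy_var P g (U j) (B j))) i =
      trace_jump (rec_minus (\<lambda>j. T (roe_state P ?U j)) (\<lambda>j. entropy_var P g (?U j) (?B j)))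
        (rec_plus (\<lambda>j. T (roe_state P ?U j)) (\<lambda>j. entropy_var P g (?U j) (?B j))) 0"
    by (rule rec_jump_cong) (simp_all only: roe, simp_all add: stencil_def)
  moreover have "ec_flux P g U i = ec_flux P g ?U 0"
    by (rule ec_flux_cong) (simp_all add: stencil_def)
  ultimately show ?thesis by (simp only: es2_flux_def Let_def roe)
qed

context symmetric_trilinear begin

text \<open>Tadmor's numerical entropy flux with a bottom correction. The source pairs the bottom
  jump with the velocities of the cells, the identity at the interface with their mean; the two
  differ by half a velocity jump, and the weight \<open>g / 2\<close> becomes
  \<open>g / 4\<close>.\<close>

definition entropy_flux ::
    "real \<Rightarrow> ((int \<Rightarrow> 'k state) \<Rightarrow> (int \<Rightarrow> real ^ 'k) \<Rightarrow> int \<Rightarrow> 'k state)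
     \<Rightarrow> (int \<Rightarrow> 'k state) \<Rightarrow> (int \<Rightarrow> real ^ 'k) \<Rightarrow> int \<Rightarrow> real" where
  "entropy_flux g F U B i =
     avg (\<lambda>j. entropy_var P g (U j) (B j)) i \<bullet> F U B i
     - (g / 4) * (jump (\<lambda>j. velocity P (U j)) i \<bullet> (P (avg (\<lambda>j. height (U j)) i) *v jump B i))
     - avg (\<lambda>j. entropy_potential g (U j)) i"

lemma entropy_flux_stencil:
  "entropy_flux g (es2_flux P g T L) U B i =
     entropy_flux g (es2_flux P g T L) (stencil (U (i - 1)) (U i) (U (i + 1)) (U (i + 2)))
       (stencil (B (i - 1)) (B i) (B (i + 1)) (B (i + 2))) 0"
  unfolding entropy_flux_def es2_flux_stencil[of P g T L U B i]
  by (simp add: avg_def jump_def stencil_def)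

text \<open>All scaled jumps vanish, so the limiter has nothing to reconstruct. This serves both the
  lake at rest and the consistency of the numerical entropy flux.\<close>

lemma es2_flux_constant_entropy:
  assumes "\<And>j. entropy_var P g (U j) (B j) = v"
    and "invertible (T (roe_state P U i))"
  shows "es2_flux P g T L U B i = ec_flux P g U i"
proof -
  have w: "scaled_jump R (\<lambda>j. entropy_var P g (U j) (B j)) j = 0" for R j
    by (simp add: scaled_jump_eq jump_def assms(1))
  have "rec_scaled_jump R (\<lambda>j. entropy_var P g (U j) (B j)) i = 0" for R
    by (simp add: vec_eq_iff rec_scaled_jump_component w)
  then show ?thesis
    unfolding es2_flux_def Let_def
    using diffusion_rec_jump[of "\<lambda>j. T (roe_state P U j)" i, OF assms(2)] by simp
qed

lemma entropy_flux_consistent: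
  assumes "pos_def (P (height U))"
    and "invertible (T (roe_state P (\<lambda>_. U) 0))"
  shows "entropy_flux g (es2_flux P g T L) (\<lambda>_. U) (\<lambda>_. b) 0 = energy_flux P g U b"
proof -
  define u where "u = velocity P U"
  define h where "h = height U"
  define q where "q = discharge U"
  have q: "P h *v u = q" using P_velocity[OF assms(1)] by (simp add: h_def u_def q_def)
  have F: "es2_flux P g T L (\<lambda>_. U) (\<lambda>_. b) 0 = mk_state q ((g / 2) *\<^sub>R (P h *v h) + P u *v q)"
  proof (subst es2_flux_constant_entropy)
    show "ec_flux P g (\<lambda>_. U) 0 = mk_state q ((g / 2) *\<^sub>R (P h *v h) + P u *v q)"
      by (simp add: ec_flux_def Let_def avg_def scaleR_half_double u_def[symmetric] h_def[symmetric] q)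
  qed (rule refl, fact)
  have "entropy_var P g U b \<bullet> mk_state q ((g / 2) *\<^sub>R (P h *v h) + P u *v q) - entropy_potential g U
      = - (1 / 2) * ((P u *v u) \<bullet> q) + g * (q \<bullet> (h + b)) + u \<bullet> (P u *v q)"
    by (simp add: entropy_var_def entropy_potential_def inner_state u_def[symmetric]
        h_def[symmetric] Let_def inner_diff_left inner_add_left inner_add_right inner_commute
        algebra_simps)
  moreover have "(P u *v u) \<bullet> q = u \<bullet> (P q *v u)" "u \<bullet> (P u *v q) = u \<bullet> (P q *v u)"
    using inner_P[of u u q] inner_P'(2)[of u u q] by simp_all
  ultimately show ?thesis
    by (simp add: entropy_flux_def F avg_def jump_def scaleR_half_double energy_flux_def Let_def
        u_def[symmetric] h_def[symmetric] q_def[symmetric])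
qed

text \<open>Each cell value at an interface is written as the mean plus or minus half the jump. The
  means form \<open>entropy_flux\<close>, the jumps are controlled by \<open>ec_flux_entropy\<close>
  and the sign of the diffusion, and the potential of cell \<open>i\<close> cancels between its two
  interfaces.\<close>

lemma energy_dissipation:
  fixes F :: "(int \<Rightarrow> 'k state) \<Rightarrow> (int \<Rightarrow> real ^ 'k) \<Rightarrow> int \<Rightarrow> 'k state"
  assumes dx: "0 < dx"
    and F: "\<And>j. 0 \<le> jump (\<lambda>j. entropy_var P g (U j) (B j)) j \<bullet> (ec_flux P g U j - F U B j)"
  shows "entropy_var P g (U i) (B i) \<bullet> fv_rhs F (discrete_source P g) dx U B i
    \<le> - (1 / dx) * (entropy_flux g F U B i - entropy_flux g F U B (i - 1))"
proof -
  define V where "V = (\<lambda>j. entropy_var P g (U j) (B j))"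
  define u where "u = (\<lambda>j. velocity P (U j))"
  define x where "x = (\<lambda>j. P (avg (\<lambda>j. height (U j)) j) *v jump B j)"
  define \<psi> where "\<psi> = (\<lambda>j. entropy_potential g (U j))"
  define H where "H = entropy_flux g F U B"
  \<comment> \<open>The identity of \<open>ec_flux_entropy\<close> becomes an inequality when the
    dissipative flux replaces the conservative one.\<close>
  have N: "(V (j + 1) - V j) \<bullet> F U B j - (g / 2) * ((u j + u (j + 1)) \<bullet> x j) \<le> \<psi> (j + 1) - \<psi> j" for j
    using F[of j] ec_flux_entropy[of g U B j]
    by (simp add: V_def u_def x_def \<psi>_def inner_diff_right avg_def[of "\<lambda>j. velocity P (U j)"]
        jump_def[of "\<lambda>j. entropy_var P g (U j) (B j)"] jump_def[of "\<lambda>j. entropy_potential g (U j)"])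
  have H: "H j = (1 / 2) * (V j \<bullet> F U B j + V (j + 1) \<bullet> F U B j)
      - (g / 4) * (u (j + 1) \<bullet> x j - u j \<bullet> x j) - (1 / 2) * (\<psi> j + \<psi> (j + 1))" for j
    by (simp add: H_def entropy_flux_def V_def u_def x_def \<psi>_def avg_def[of "\<lambda>j. entropy_potential g (U j)"]
        avg_def[of "\<lambda>j. entropy_var P g (U j) (B j)"] jump_def[of "\<lambda>j. velocity P (U j)"]
        inner_add_left inner_diff_left)
  \<comment> \<open>\<open>Z\<close> is the energy production of cell \<open>i\<close> multiplied by
    \<open>- dx\<close>.\<close>
  define Z where "Z = V i \<bullet> F U B i - V i \<bullet> F U B (i - 1) + (g / 2) * (u i \<bullet> x i + u i \<bullet> x (i - 1))"
  have "discharge (V i) = u i" by (simp add: V_def u_def entropy_var_def Let_def)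
  then have S: "V i \<bullet> discrete_source P g dx U B i = - (g / (2 * dx)) * (u i \<bullet> x i + u i \<bullet> x (i - 1))"
    by (simp add: discrete_source_def Let_def inner_state x_def inner_add_right)
  have "V i \<bullet> fv_rhs F (discrete_source P g) dx U B i = - (1 / dx) * Z"
    unfolding fv_rhs_def inner_add_right S Z_def
    by (simp add: inner_diff_right distrib_left)
  moreover have "H i - H (i - 1) \<le> Z"
    using N[of i] N[of "i - 1"] unfolding H Z_def
    by (simp add: inner_diff_left inner_add_left algebra_simps)
  then have "- (1 / dx) * Z \<le> - (1 / dx) * (H i - H (i - 1))"
    using dx by (intro mult_left_mono_neg) auto
  ultimately show ?thesis by (simp add: V_def H_def)
qed

definition diagonalizing :: "('k state \<Rightarrow> 'k state_matrix) \<Rightarrow> ('k state \<Rightarrow> 'k state_matrix) \<Rightarrow> bool" where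
  "diagonalizing T L \<longleftrightarrow> (\<forall>U. pos_def (P (height U)) \<longrightarrow> invertible (T U) \<and> diagonal (L U))"

lemma energy_stable_es2:
  assumes "diagonalizing T L"
  shows "energy_stable P g (fv_rhs (es2_flux P g T L) (discrete_source P g))"
proof -
  let ?F = "es2_flux P g T L"
  let ?H = "\<lambda>a b c d ba bb bc bd. entropy_flux g ?F (stencil a b c d) (stencil ba bb bc bd) 0"
  have "?H U U U U b b b b = energy_flux P g U b" if "pos_def (P (height U))" for U b
  proof -
    have s: "stencil x x x x = (\<lambda>_. x)" for x :: 'z by (auto simp: stencil_def)
    show ?thesis
      unfolding s using that assms pos_def_roe_state[of "\<lambda>_. U" 0]
      by (intro entropy_flux_consistent) (auto simp: diagonalizing_def)
  qed
  \<comment> \<open>The indices of interface \<open>i - 1\<close> stay unsimplified, so that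
    \<open>entropy_flux_stencil\<close> can be folded back.\<close>
  moreover have "\<exists>D. ((\<lambda>s. energy P g (U s i) (B i)) has_real_derivative D) (at t within J) \<and>
      D \<le> - (1 / dx) *
        (?H (U t (i - 1)) (U t i) (U t (i + 1)) (U t (i + 2)) (B (i - 1)) (B i) (B (i + 1)) (B (i + 2)) -
         ?H (U t (i - 1 - 1)) (U t (i - 1)) (U t (i - 1 + 1)) (U t (i - 1 + 2))
            (B (i - 1 - 1)) (B (i - 1)) (B (i - 1 + 1)) (B (i - 1 + 2)))"
    if dx: "0 < dx" and "scheme_at P (fv_rhs ?F (discrete_source P g)) dx U B J t" for dx U B J t i
  proof -
    have pd: "pos_def (P (height (U t i)))"
      and U: "((\<lambda>s. U s i) has_vector_derivative fv_rhs ?F (discrete_source P g) dx (U t) B i) (at t within J)"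
      for i using that(2) by (auto simp: scheme_at_def)
    have "0 \<le> jump (\<lambda>j. entropy_var P g (U t j) (B j)) j \<bullet> (ec_flux P g (U t) j - ?F (U t) B j)" for j
    proof -
      have "pos_def (P (height (roe_state P (U t) j)))" by (intro pos_def_roe_state pd)
      then show ?thesis
        using diffusion_nonneg[of "\<lambda>j. T (roe_state P (U t) j)" j "L (roe_state P (U t) j)"
            "\<lambda>j. entropy_var P g (U t j) (B j)"] assms
        by (simp add: es2_flux_def Let_def diagonalizing_def)
    qed
    from energy_dissipation[of dx g "U t" B ?F i, OF dx this] energy_has_derivative[OF pd U]
    show ?thesis unfolding entropy_flux_stencil[symmetric] by blast
  qed
  ultimately show ?thesis unfolding energy_stable_def Let_def by (intro exI[of _ ?H]) blast
qed

lemma well_balanced_es2: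
  assumes "diagonalizing T L"
  shows "well_balanced P (fv_rhs (es2_flux P g T L) (discrete_source P g))"
  unfolding well_balanced_def
proof (intro allI impI)
  fix dx :: real and U :: "real \<Rightarrow> int \<Rightarrow> 'k state" and B J t i
  let ?F = "es2_flux P g T L"
  assume dx: "0 < dx" and s: "scheme_at P (fv_rhs ?F (discrete_source P g)) dx U B J t"
    and u: "\<forall>i. velocity P (U t i) = 0" and "\<exists>c. \<forall>i. height (U t i) + B i = c"
  then obtain c where c: "\<And>i. height (U t i) + B i = c" by blast
  have pd: "pos_def (P (height (U t i)))"
    and U: "((\<lambda>s. U s i) has_vector_derivative fv_rhs ?F (discrete_source P g) dx (U t) B i) (at t within J)"
    for i using s by (auto simp: scheme_at_def)
  define h where "h = (\<lambda>i. height (U t i))"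
  \<comment> \<open>At rest the entropy variable is \<open>mk_state (g *\<^sub>R c) 0\<close> in
    every cell, and of the conservative flux only the mean hydrostatic pressure survives.\<close>
  have F: "?F (U t) B j = mk_state 0 ((g / 4) *\<^sub>R (P (h j) *v h j + P (h (j + 1)) *v h (j + 1)))" for j
  proof -
    have "pos_def (P (height (roe_state P (U t) j)))" by (intro pos_def_roe_state pd)
    then have "?F (U t) B j = ec_flux P g (U t) j"
      using assms u c unfolding diagonalizing_def
      by (intro es2_flux_constant_entropy[where v = "mk_state (g *\<^sub>R c) 0"])
        (auto simp: entropy_var_def Let_def)
    then show ?thesis using u by (simp add: ec_flux_def avg_def Let_def h_def)
  qed
  \<comment> \<open>A constant surface turns bottom jumps into negative height jumps, and the
    difference of squares expresses the source through the same pressures as the flux.\<close>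
  have S: "P (avg h j) *v jump B j = (1 / 2) *\<^sub>R (P (h j) *v h j - P (h (j + 1)) *v h (j + 1))" for j
  proof -
    have "jump B j = h j - h (j + 1)"
      using c[of j] c[of "j + 1"] by (simp add: jump_def h_def algebra_simps)
    then show ?thesis
      using commute[of "h j" "h (j + 1)"]
      by (simp add: avg_def B.scaleR_left B.add_left B.diff_right scaleR_diff_right scaleR_add_right)
  qed
  \<comment> \<open>Adding the contributions of both interfaces removes the pressure of cell
    \<open>i\<close>; the flux difference leaves the same two neighbours with opposite sign.\<close>
  have "discrete_source P g dx (U t) B i =
      mk_state 0 (- (g / (4 * dx)) *\<^sub>R (P (h (i - 1)) *v h (i - 1) - P (h (i + 1)) *v h (i + 1)))"
    unfolding discrete_source_def Let_def h_def[symmetric] S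
    by (simp add: scaleR_add_right[symmetric] del: scaleR_minus_left)
  moreover have "- ((1 / dx) *\<^sub>R (?F (U t) B i - ?F (U t) B (i - 1))) =
      mk_state 0 ((g / (4 * dx)) *\<^sub>R (P (h (i - 1)) *v h (i - 1) - P (h (i + 1)) *v h (i + 1)))"
    unfolding F by (simp add: mk_state_diff scaleR_diff_right[symmetric] mk_state_scaleR
        scaleR_minus_left[symmetric] del: scaleR_minus_left)
      (simp add: algebra_simps mk_state_minus)
  ultimately have "fv_rhs ?F (discrete_source P g) dx (U t) B i = 0"
    by (simp add: fv_rhs_def mk_state_add)
  then have "((\<lambda>s. U s i) has_vector_derivative 0) (at t within J)" using U[of i] by simp
  from bounded_linear.has_vector_derivative[OF bounded_linear_height this]
    bounded_linear.has_vector_derivative[OF bounded_linear_discharge this]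
  show "((\<lambda>s. height (U s i)) has_vector_derivative 0) (at t within J) \<and>
        ((\<lambda>s. discharge (U s i)) has_vector_derivative 0) (at t within J)" by simp
qed

end

section \<open>Near-linearity of cell averages\<close>

lemma smoothE:
  assumes "smooth f"
  obtains D where "D 0 = f" "\<And>n x. (D n has_vector_derivative D (Suc n) x) (at x)"
  using assms unfolding smooth_def by blast

lemma smooth_continuous_on: "smooth f \<Longrightarrow> continuous_on S f"
  by (elim smoothE) (metis continuous_at_imp_continuous_on differentiable_imp_continuous_within
      differentiableI_vector)

lemma bigo_on_mesh_power:
  assumes "bigo_on X (\<lambda>p. fst p ^ n) f" "m \<le> n" "X \<subseteq> mesh a b"
  shows "bigo_on X (\<lambda>p. fst p ^ m) f"
  using assms(3) mesh_size assms(2)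
  by (intro bigo_on_mono[OF assms(1)]) (auto intro!: power_decreasing dest!: subsetD)

lemma bigo_on_mesh_scaleR:
  assumes "bigo_on (mesh a b) (\<lambda>_. 1) f"
  shows "bigo_on (mesh a b) (\<lambda>p. fst p ^ n) (\<lambda>p. (c * fst p ^ n) *\<^sub>R f p)"
proof -
  have "bigo_on (mesh a b) (\<lambda>p. fst p ^ n) (\<lambda>p. fst p ^ n)"
    using mesh_size by (intro bigo_on_self) force
  from bigo_on_scaleR[OF bigo_on_bilinear[OF bounded_bilinear_scaleR this assms], of c]
  show ?thesis by simp
qed

lemma avg_at_linear_expansion:
  fixes D :: "nat \<Rightarrow> real \<Rightarrow> 'a::euclidean_space"
  assumes D: "\<And>n x. (D n has_vector_derivative D (Suc n) x) (at x)"
  shows "bigo_on (mesh a b) (\<lambda>p. (fst p)\<^sup>2)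
           (\<lambda>p. avg_at (D 0) k p - D 0 (center p) - (of_int k * fst p) *\<^sub>R D 1 (center p))"
proof -
  have "bigo_on (mesh a b) (\<lambda>p. (fst p)\<^sup>2)
      (\<lambda>p. (((of_int k)\<^sup>2 / 2 + 1 / 24) * (fst p)\<^sup>2) *\<^sub>R D 2 (center p))"
    by (intro bigo_on_mesh_scaleR derivatives_bigo D)
  from bigo_on_add[OF bigo_on_mesh_power[OF avg_at_expansion[where D = D and k = k, OF D], of 2] this]
  show ?thesis by (rule bigo_on_cong) auto
qed

lemma point_linear_expansion:
  fixes D :: "nat \<Rightarrow> real \<Rightarrow> 'a::real_normed_vector"
  assumes D: "\<And>n x. (D n has_vector_derivative D (Suc n) x) (at x)"
  shows "bigo_on (mesh a b) (\<lambda>p. (fst p)\<^sup>2)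
           (\<lambda>p. D 0 (center p + s * fst p) - D 0 (center p) - (s * fst p) *\<^sub>R D 1 (center p))"
  by (rule bigo_on_cong[OF mesh_taylor[of D, OF D, where n = 2]])
    (simp_all add: numeral_2_eq_2 algebra_simps)

lemma near_linear_cells:
  assumes "smooth f"
  shows "near_linear (mesh a b) fst (avg_at f (k - 1)) (avg_at f k) (avg_at f (k + 1))"
proof -
  obtain D where D: "D 0 = f" "\<And>n x. (D n has_vector_derivative D (Suc n) x) (at x)"
    using smoothE[OF assms] by blast
  show ?thesis unfolding D(1)[symmetric]
    using mesh_size
    by (intro near_linear_expansion[OF derivatives_bigo[of D, OF D(2)] derivatives_bigo[of D, OF D(2)]
          avg_at_linear_expansion[of D, OF D(2)] avg_at_linear_expansion[of D, OF D(2)]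
          avg_at_linear_expansion[of D, OF D(2)]]) auto
qed

text \<open>Everything is expanded about the center of the left cell, with linear coefficients
  \<open>0\<close>, \<open>1 / 2\<close> and \<open>1\<close>.\<close>

lemma near_linear_interface:
  assumes "smooth f"
  shows "near_linear (mesh a b) fst (avg_at f 0) (\<lambda>p. f (center p + (1 / 2) * fst p)) (avg_at f 1)"
proof -
  obtain D where D: "D 0 = f" "\<And>n x. (D n has_vector_derivative D (Suc n) x) (at x)"
    using smoothE[OF assms] by blast
  show ?thesis unfolding D(1)[symmetric]
    using mesh_size
    by (intro near_linear_expansion[OF derivatives_bigo[of D, OF D(2)] derivatives_bigo[of D, OF D(2)]
          avg_at_linear_expansion[of D, OF D(2)] point_linear_expansion[of D, OF D(2)]
          avg_at_linear_expansion[of D, OF D(2)]]) auto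
qed

lemma near_linear_mk_state:
  fixes hl :: "'p \<Rightarrow> real ^ 'n::finite"
  assumes "near_linear X d hl hm hr" "near_linear X d ql qm qr"
  shows "near_linear X d (\<lambda>p. mk_state (hl p) (ql p)) (\<lambda>p. mk_state (hm p) (qm p))
    (\<lambda>p. mk_state (hr p) (qr p))"
proof -
  have l: "bounded_linear (\<lambda>h. mk_state h (0 :: real ^ 'n))" "bounded_linear (mk_state (0 :: real ^ 'n))"
    using bounded_linear_compose[OF bounded_linear_mk_state, of "\<lambda>h. (h, 0)"]
      bounded_linear_compose[OF bounded_linear_mk_state, of "\<lambda>q. (0, q)"]
    by (simp_all add: bounded_linear_Pair bounded_linear_ident bounded_linear_zero)
  from near_linear_add[OF near_linear_linear[OF l(1) assms(1)] near_linear_linear[OF l(2) assms(2)]]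
  show ?thesis by (simp add: mk_state_add)
qed

lemma bigo_on_mk_state:
  assumes "bigo_on X e h" "bigo_on X e q"
  shows "bigo_on X e (\<lambda>p. mk_state (h p) (q p))"
proof -
  obtain C D where C: "\<And>p. p \<in> X \<Longrightarrow> norm (h p) \<le> C * e p" "\<And>p. p \<in> X \<Longrightarrow> norm (q p) \<le> D * e p"
    using bigo_onE[OF assms(1)] bigo_onE[OF assms(2)] by metis
  show ?thesis
  proof (rule bigo_onI)
    fix p assume p: "p \<in> X"
    show "norm (mk_state (h p) (q p)) \<le> (C + D) * e p"
      using norm_state_le[of "mk_state (h p) (q p)"] C(1)[OF p] C(2)[OF p]
      by (simp add: distrib_right)
  qed
qed

context symmetric_trilinear begin

section \<open>Uniform coercivity and differences of velocity and entropy variable\<close>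

definition coercive_on :: "'p set \<Rightarrow> ('p \<Rightarrow> real ^ 'k) \<Rightarrow> bool" where
  "coercive_on X h \<longleftrightarrow> (\<exists>c>0. \<forall>p\<in>X. coercive c (h p))"

lemma coercive_on_subset: "coercive_on X h \<Longrightarrow> Y \<subseteq> X \<Longrightarrow> coercive_on Y h"
  unfolding coercive_on_def by blast

lemma coercive_on_pos_def: "coercive_on X h \<Longrightarrow> p \<in> X \<Longrightarrow> pos_def (P (h p))"
  unfolding coercive_on_def using coercive_pos_def by blast

lemma coercive_on_average:
  assumes "coercive_on X h" "coercive_on X h'"
  shows "coercive_on X (\<lambda>p. (1 / 2) *\<^sub>R (h p + h' p))"
proof -
  obtain c where c: "0 < c" "\<And>p. p \<in> X \<Longrightarrow> coercive c (h p)"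
    using assms(1) unfolding coercive_on_def by blast
  obtain c' where c': "0 < c'" "\<And>p. p \<in> X \<Longrightarrow> coercive c' (h' p)"
    using assms(2) unfolding coercive_on_def by blast
  have "coercive (min c c') ((1 / 2) *\<^sub>R (h p + h' p))" if "p \<in> X" for p
    by (rule coercive_average[OF coercive_mono[OF c(2)[OF that]] coercive_mono[OF c'(2)[OF that]]])
      simp_all
  then show ?thesis unfolding coercive_on_def using c(1) c'(1) by (intro exI[of _ "min c c'"]) simp
qed

lemma bigo_on_solve:
  assumes "coercive_on X h" "bigo_on X e (\<lambda>p. P (h p) *v v p)"
  shows "bigo_on X e v"
proof -
  obtain c where c: "0 < c" "\<And>p. p \<in> X \<Longrightarrow> coercive c (h p)"
    using assms(1) unfolding coercive_on_def by blast
  obtain C where C: "\<And>p. p \<in> X \<Longrightarrow> norm (P (h p) *v v p) \<le> C * e p"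
    using bigo_onE[OF assms(2)] by blast
  show ?thesis
  proof (rule bigo_onI)
    fix p assume p: "p \<in> X"
    have "norm (v p) \<le> norm (P (h p) *v v p) / c" by (rule coercive_bound[OF c(2)[OF p] c(1)])
    also have "\<dots> \<le> C * e p / c" using C[OF p] c(1) by (simp add: divide_right_mono)
    finally show "norm (v p) \<le> C / c * e p" by simp
  qed
qed

text \<open>Differences of the equation \<open>P h *v u = q\<close> are again equations for
  differences of \<open>u\<close>, with a uniformly invertible matrix. The right-hand side of the
  second one contains the second differences of \<open>q\<close> and \<open>h\<close> and products
  of first differences of \<open>h\<close> and \<open>u\<close>.\<close>

lemma near_linear_solve:
  assumes h: "near_linear X d hl hm hr" and q: "near_linear X d ql qm qr"
    and c: "coercive_on X hl" "coercive_on X hm" "coercive_on X hr"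
    and u: "\<And>p. p \<in> X \<Longrightarrow> P (hl p) *v ul p = ql p" "\<And>p. p \<in> X \<Longrightarrow> P (hm p) *v um p = qm p"
      "\<And>p. p \<in> X \<Longrightarrow> P (hr p) *v ur p = qr p"
  shows "near_linear X d ul um ur"
proof -
  note nh = h[unfolded near_linear_def] and nq = q[unfolded near_linear_def]
  note bb = bigo_on_bilinear[OF bounded_bilinear]
  have um: "bigo_on X (\<lambda>_. 1) um"
  proof (rule bigo_on_solve[OF c(2)])
    show "bigo_on X (\<lambda>_. 1) (\<lambda>p. P (hm p) *v um p)"
    proof (rule bigo_on_cong)
      show "bigo_on X (\<lambda>_. 1) qm" using nq by blast
    qed (simp_all add: u(2))
  qed
  have hu: "bigo_on X e (\<lambda>p. P (f p) *v um p)" if "bigo_on X e f" for e f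
    using bb[OF that um] by simp
  have first: "bigo_on X d (\<lambda>p. v p - um p)"
    if "coercive_on X h" "bigo_on X d (\<lambda>p. q p - qm p)" "bigo_on X d (\<lambda>p. h p - hm p)"
      and v: "\<And>p. p \<in> X \<Longrightarrow> P (h p) *v v p = q p" for h q v
  proof (rule bigo_on_solve[OF that(1)])
    show "bigo_on X d (\<lambda>p. P (h p) *v (v p - um p))"
      by (rule bigo_on_cong[OF bigo_on_diff[OF that(2) hu[OF that(3)]]])
        (simp_all add: v u(2)[symmetric] B.diff_left B.diff_right)
  qed
  have ul: "bigo_on X d (\<lambda>p. ul p - um p)"
    using nq nh by (intro first[OF c(1) _ _ u(1)]) auto
  have ur: "bigo_on X d (\<lambda>p. ur p - um p)"
    using nq nh by (intro first[OF c(3) _ _ u(3)]) auto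
  have "bigo_on X (\<lambda>p. (d p)\<^sup>2) (\<lambda>p. P (hl p - hm p) *v (ul p - um p))"
    unfolding power2_eq_square using nh ul by (intro bb) auto
  moreover have "bigo_on X (\<lambda>p. (d p)\<^sup>2) (\<lambda>p. P (hr p - hm p) *v (ur p - um p))"
    unfolding power2_eq_square using nh ur by (intro bb) auto
  moreover have "bigo_on X (\<lambda>p. (d p)\<^sup>2) (\<lambda>p. P (hl p + hr p - 2 *\<^sub>R hm p) *v um p)"
    using nh by (intro hu) auto
  ultimately have "bigo_on X (\<lambda>p. (d p)\<^sup>2) (\<lambda>p. ql p + qr p - 2 *\<^sub>R qm p
      - (P (hl p + hr p - 2 *\<^sub>R hm p) *v um p
         + (P (hl p - hm p) *v (ul p - um p) + P (hr p - hm p) *v (ur p - um p))))"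
    using nq by (intro bigo_on_diff[OF _ bigo_on_add[OF _ bigo_on_add]]) auto
  then have "bigo_on X (\<lambda>p. (d p)\<^sup>2) (\<lambda>p. P (hm p) *v (ul p + ur p - 2 *\<^sub>R um p))"
    by (rule bigo_on_cong)
      (auto simp: u[symmetric] B.add_left B.add_right B.diff_left B.diff_right B.scaleR_left
        B.scaleR_right algebra_simps, simp add: scaleR_2)
  from bigo_on_solve[OF c(2) this] um ul ur show ?thesis by (simp add: near_linear_def)
qed

lemma near_linear_velocity:
  assumes U: "near_linear X d Ul Um Ur"
    and c: "coercive_on X (\<lambda>p. height (Ul p))" "coercive_on X (\<lambda>p. height (Um p))"
      "coercive_on X (\<lambda>p. height (Ur p))"
  shows "near_linear X d (\<lambda>p. velocity P (Ul p)) (\<lambda>p. velocity P (Um p)) (\<lambda>p. velocity P (Ur p))"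
  using near_linear_linear[OF bounded_linear_height U] near_linear_linear[OF bounded_linear_discharge U] c
  by (rule near_linear_solve) (auto intro!: P_velocity dest: coercive_on_pos_def[OF c(1)]
      coercive_on_pos_def[OF c(2)] coercive_on_pos_def[OF c(3)])

lemma near_linear_entropy_var:
  assumes U: "near_linear X d Ul Um Ur" and b: "near_linear X d bl bm br"
    and c: "coercive_on X (\<lambda>p. height (Ul p))" "coercive_on X (\<lambda>p. height (Um p))"
      "coercive_on X (\<lambda>p. height (Ur p))"
    and d: "\<And>p. p \<in> X \<Longrightarrow> 0 \<le> d p \<and> d p \<le> 1"
  shows "near_linear X d (\<lambda>p. entropy_var P g (Ul p) (bl p)) (\<lambda>p. entropy_var P g (Um p) (bm p))
    (\<lambda>p. entropy_var P g (Ur p) (br p))"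
  unfolding entropy_var_def Let_def
  by (intro near_linear_mk_state near_linear_add near_linear_linear[OF bounded_linear_scaleR_right]
      near_linear_bilinear[OF bounded_bilinear] near_linear_velocity U b c d
      near_linear_linear[OF bounded_linear_height])

text \<open>For a fixed vector the quadratic form is linear in the state, so it commutes with the
  integral and the pointwise lower bound survives averaging.\<close>

lemma coercive_cell_average:
  assumes U: "continuous_on {l..r} U" and lr: "l < r"
    and c: "\<And>x. x \<in> {l..r} \<Longrightarrow> coercive c (height (U x))"
  shows "coercive c (height ((1 / (r - l)) *\<^sub>R integral {l..r} U))"
  unfolding coercive_def
proof
  fix v
  let ?f = "\<lambda>W. v \<bullet> (P (height W) *v v)"
  have lin: "bounded_linear ?f"
    by (intro bounded_linear_compose[OF bounded_linear_inner_right]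
        bounded_linear_compose[OF B.bounded_linear_left] bounded_linear_height)
  have "(U has_integral integral {l..r} U) {l..r}"
    using integrable_continuous_real[OF U] by (rule integrable_integral)
  from has_integral_linear[OF this lin]
  have f: "((\<lambda>x. ?f (U x)) has_integral ?f (integral {l..r} U)) {l..r}" by (simp add: o_def)
  have "((\<lambda>x. c * (v \<bullet> v)) has_integral (r - l) *\<^sub>R (c * (v \<bullet> v))) {l..r}"
    using has_integral_const_real[of "c * (v \<bullet> v)" l r] lr by simp
  from has_integral_le[OF this f]
  have "(r - l) *\<^sub>R (c * (v \<bullet> v)) \<le> ?f (integral {l..r} U)"
    using c unfolding coercive_def by blast
  then show "c * (v \<bullet> v) \<le> ?f ((1 / (r - l)) *\<^sub>R integral {l..r} U)"
    using lr by (simp add: B.scaleR_left field_simps)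
qed

lemma coercive_on_avg_at:
  assumes U: "smooth U" and pd: "\<And>x. pos_def (P (height (U x)))"
  shows "coercive_on (mesh a b) (\<lambda>p. height (avg_at U k p))"
proof -
  \<comment> \<open>The cell with offset \<open>k\<close> reaches at most
    \<open>\<bar>k\<bar> + 1 / 2\<close> mesh sizes away from the center, and mesh sizes are below
    \<open>1\<close>.\<close>
  let ?I = "{a - \<bar>of_int k\<bar> - 1..b + \<bar>of_int k\<bar> + 1 :: real}"
  have "continuous_on ?I (\<lambda>x. height (U x))"
    by (intro bounded_linear.continuous_on[OF bounded_linear_height] smooth_continuous_on[OF U])
  then obtain c where c: "0 < c" "\<And>x. x \<in> ?I \<Longrightarrow> coercive c (height (U x))"
    using coercive_compact[of ?I "\<lambda>x. height (U x)"] pd by blast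
  have "coercive c (height (avg_at U k p))" if p: "p \<in> mesh a b" for p
  proof -
    let ?l = "interface (fst (snd p)) (fst p) (snd (snd p) + k - 1)"
    let ?r = "interface (fst (snd p)) (fst p) (snd (snd p) + k)"
    have d: "0 < fst p" "fst p < 1" using mesh_size[OF p] by auto
    have l: "?l = center p + (of_int k - 1 / 2) * fst p"
      and r: "?r = center p + (of_int k + 1 / 2) * fst p"
      by (simp_all add: interface_def center_def cell_center_def algebra_simps)
    have len: "?r - ?l = fst p" unfolding l r by (simp add: algebra_simps)
    have "\<bar>of_int k * fst p\<bar> \<le> \<bar>real_of_int k\<bar>"
      using d by (simp add: abs_mult mult_left_le)
    then have "{?l..?r} \<subseteq> ?I"
      using p d unfolding l r mesh_def by (auto simp: algebra_simps abs_le_iff)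
    then have "coercive c (height ((1 / (?r - ?l)) *\<^sub>R integral {?l..?r} U))"
      using len d c(2) by (intro coercive_cell_average smooth_continuous_on[OF U]) auto
    then show ?thesis by (simp add: len avg_at_def cell_average_def)
  qed
  then show ?thesis using c(1) unfolding coercive_on_def by blast
qed

lemma coercive_on_point:
  assumes U: "smooth U" and pd: "\<And>x. pos_def (P (height (U x)))"
  shows "coercive_on (mesh a b) (\<lambda>p. height (U (center p + (1 / 2) * fst p)))"
proof -
  let ?I = "{a..b + 1 :: real}"
  have "continuous_on ?I (\<lambda>x. height (U x))"
    by (intro bounded_linear.continuous_on[OF bounded_linear_height] smooth_continuous_on[OF U])
  then obtain c where c: "0 < c" "\<And>x. x \<in> ?I \<Longrightarrow> coercive c (height (U x))"
    using coercive_compact[of ?I "\<lambda>x. height (U x)"] pd by blast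
  then show ?thesis unfolding coercive_on_def
    by (intro exI[of _ c]) (auto simp: mesh_def)
qed

end

section \<open>Truncation error of the flux\<close>

lemma bigo_on_vec:
  fixes f :: "'p \<Rightarrow> real ^ 'n::finite"
  assumes "\<And>k. bigo_on X e (\<lambda>p. f p $ k)"
  shows "bigo_on X e f"
proof -
  obtain C where C: "\<And>k p. p \<in> X \<Longrightarrow> \<bar>f p $ k\<bar> \<le> C k * e p"
    using assms unfolding bigo_on_def real_norm_def by metis
  show ?thesis
  proof (rule bigo_onI)
    fix p assume p: "p \<in> X"
    have "norm (f p) \<le> (\<Sum>k\<in>UNIV. \<bar>f p $ k\<bar>)" by (rule norm_le_l1_cart)
    also have "\<dots> \<le> (\<Sum>k\<in>UNIV. C k * e p)" by (intro sum_mono C p)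
    finally show "norm (f p) \<le> (\<Sum>k\<in>UNIV. C k) * e p" by (simp add: sum_distrib_right)
  qed
qed

lemma bigo_on_component:
  "bigo_on X e f \<Longrightarrow> bigo_on X e (\<lambda>p. f p $ k)" for f :: "'p \<Rightarrow> real ^ 'n::finite"
  by (rule bigo_on_linear[OF bounded_linear_vec_nth])

lemma bigo_on_abs_diagonal:
  fixes A :: "'p \<Rightarrow> real ^ 'n::finite ^ 'n"
  assumes "\<And>p. p \<in> X \<Longrightarrow> diagonal (A p)" "\<And>k. bigo_on X (\<lambda>_. 1) (\<lambda>p. A p $ k $ k)"
    and "bigo_on X e w"
  shows "bigo_on X e (\<lambda>p. abs_entries (A p) *v w p)"
proof (rule bigo_on_vec)
  fix k
  have "bigo_on X (\<lambda>_. 1) (\<lambda>p. \<bar>A p $ k $ k\<bar>)"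
    using assms(2)[of k] by (simp add: bigo_on_def)
  from bigo_on_bilinear[OF bounded_bilinear_mult this bigo_on_component[OF assms(3), of k]]
  show "bigo_on X e (\<lambda>p. (abs_entries (A p) *v w p) $ k)"
    by (rule bigo_on_cong) (simp_all add: abs_diagonal_vector assms(1))
qed

lemma eigenvector_column:
  fixes A :: "real ^ 'n::finite ^ 'n"
  assumes "invertible A" "diagonal D"
  shows "(A ** D ** matrix_inv A) *v (A *v axis k 1) = D $ k $ k *\<^sub>R (A *v axis k 1)"
    and "A *v axis k 1 \<noteq> 0"
proof -
  have "D *v axis k 1 = D $ k $ k *\<^sub>R axis k 1"
    by (simp add: vec_eq_iff diagonal_vector[OF assms(2)] axis_def)
  then show "(A ** D ** matrix_inv A) *v (A *v axis k 1) = D $ k $ k *\<^sub>R (A *v axis k 1)"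
    using matrix_inv_mult_vector(2)[OF assms(1)]
    by (simp add: matrix_vector_mul_assoc[symmetric] matrix_vector_mult_scaleR)
  show "A *v axis k 1 \<noteq> 0"
    using matrix_inv_mult_vector(2)[OF assms(1), of "axis k 1"] by (auto simp: axis_eq_0_iff)
qed

context symmetric_trilinear begin

definition sg_flux_deriv :: "real \<Rightarrow> 'k state \<Rightarrow> 'k state \<Rightarrow> 'k state" where
  "sg_flux_deriv g U W = mk_state (discharge W)
     (P (discharge U) *v velocity_deriv U W + P (discharge W) *v velocity P U
      + (g / 2) *\<^sub>R (P (height U) *v height W + P (height W) *v height U))"

lemma sg_flux_has_derivative:
  assumes "pos_def (P (height U))"
  shows "(sg_flux P g has_derivative sg_flux_deriv g U) (at U)"
proof -
  have h: "(height has_derivative height) (at U)" and q: "(discharge has_derivative discharge) (at U)"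
    by (rule bounded_linear_imp_has_derivative bounded_linear_height bounded_linear_discharge)+
  have "((\<lambda>U. (discharge U, P (discharge U) *v velocity P U + (g / 2) *\<^sub>R (P (height U) *v height U)))
      has_derivative (\<lambda>W. (discharge W,
        P (discharge U) *v velocity_deriv U W + P (discharge W) *v velocity P U
        + (g / 2) *\<^sub>R (P (height U) *v height W + P (height W) *v height U)))) (at U)"
    by (intro has_derivative_Pair has_derivative_add has_derivative_scaleR_right q
        B.FDERIV[OF q velocity_has_derivative[OF assms]] B.FDERIV[OF h h])
  from bounded_linear.has_derivative[OF bounded_linear_mk_state this]
  show ?thesis
    by (simp add: sg_flux_def[abs_def] sg_flux_deriv_def[abs_def] velocity_def Let_def)
qed

text \<open>The diagonal entries of \<open>L\<close> are eigenvalues of the Jacobian, hence bounded by its norm.\<close>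

lemma eigenvalues_bigo:
  fixes T L :: "'k state \<Rightarrow> 'k state_matrix"
  assumes eig: "\<And>U. pos_def (P (height U)) \<Longrightarrow>
      invertible (T U) \<and> diagonal (L U) \<and>
      jacobian (sg_flux P g) (at U) = T U ** L U ** matrix_inv (T U)"
    and c: "coercive_on X (\<lambda>p. height (St p))"
    and h: "bigo_on X (\<lambda>_. 1) (\<lambda>p. height (St p))"
    and u: "bigo_on X (\<lambda>_. 1) (\<lambda>p. velocity P (St p))"
  shows "bigo_on X (\<lambda>_. 1) (\<lambda>p. L (St p) $ k $ k)"
proof -
  \<comment> \<open>The normalized \<open>k\<close>-th column of the eigenvector matrix. Being of
    unit length, it is sent by the Jacobian to a vector whose norm is the modulus of the eigenvalue,
    however badly scaled the columns are.\<close>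
  define t where "t = (\<lambda>p. sgn (T (St p) *v axis k 1))"
  note pd = coercive_on_pos_def[OF c]
  have bb: "bigo_on X (\<lambda>_. 1) (\<lambda>p. P (f p) *v f' p)"
    if "bigo_on X (\<lambda>_. 1) f" "bigo_on X (\<lambda>_. 1) f'" for f f'
    using bigo_on_bilinear[OF bounded_bilinear that] by simp
  have t: "bigo_on X (\<lambda>_. 1) t" by (rule bigo_onI[where C = 1]) (simp add: t_def norm_sgn)
  have ht: "bigo_on X (\<lambda>_. 1) (\<lambda>p. height (t p))" and qt: "bigo_on X (\<lambda>_. 1) (\<lambda>p. discharge (t p))"
    by (rule bigo_on_linear[OF bounded_linear_height t] bigo_on_linear[OF bounded_linear_discharge t])+
  have q: "bigo_on X (\<lambda>_. 1) (\<lambda>p. discharge (St p))"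
    by (rule bigo_on_cong[OF bb[OF h u]]) (simp_all add: P_velocity pd)
  have "bigo_on X (\<lambda>_. 1) (\<lambda>p. discharge (t p) - P (height (t p)) *v velocity P (St p))"
    by (intro bigo_on_diff qt bb ht u)
  then have "bigo_on X (\<lambda>_. 1) (\<lambda>p. P (height (St p)) *v velocity_deriv (St p) (t p))"
    by (rule bigo_on_cong) (simp_all add: P_velocity_deriv pd)
  then have "bigo_on X (\<lambda>_. 1) (\<lambda>p. velocity_deriv (St p) (t p))" by (rule bigo_on_solve[OF c])
  then have "bigo_on X (\<lambda>_. 1) (\<lambda>p. sg_flux_deriv g (St p) (t p))"
    unfolding sg_flux_deriv_def by (intro bigo_on_mk_state bigo_on_add bigo_on_scaleR bb h ht q qt u)
  then obtain C where C: "\<And>p. p \<in> X \<Longrightarrow> norm (sg_flux_deriv g (St p) (t p)) \<le> C * 1"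
    unfolding bigo_on_def by blast
  show ?thesis
  proof (rule bigo_onI)
    fix p assume p: "p \<in> X"
    let ?J = "jacobian (sg_flux P g) (at (St p))"
    note e = eig[OF pd[OF p]]
    have D: "(sg_flux P g has_derivative sg_flux_deriv g (St p)) (at (St p))"
      by (rule sg_flux_has_derivative[OF pd[OF p]])
    \<comment> \<open>Uniqueness of the derivative identifies the Jacobian matrix with the explicit
      formula \<open>sg_flux_deriv\<close>.\<close>
    then have "(sg_flux P g has_derivative (\<lambda>W. ?J *v W)) (at (St p))"
      using jacobian_works differentiableI by blast
    from has_derivative_unique[OF D this]
    have "sg_flux_deriv g (St p) (t p) = ?J *v t p" by simp
    also have "\<dots> = L (St p) $ k $ k *\<^sub>R t p"
      using e eigenvector_column(1)[of "T (St p)" "L (St p)" k]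
      by (simp add: t_def sgn_div_norm matrix_vector_mult_scaleR)
    finally have "norm (sg_flux_deriv g (St p) (t p)) = \<bar>L (St p) $ k $ k\<bar>"
      using e eigenvector_column(2)[of "T (St p)" "L (St p)" k] by (simp add: t_def norm_sgn)
    then show "norm (L (St p) $ k $ k) \<le> C * 1" using C[OF p] by simp
  qed
qed

text \<open>Every mean in the flux is a midpoint of a near-linear triple, hence second-order close
  to its value at \<open>m\<close>; products inherit this. At \<open>m\<close> the kinetic term
  matches because \<open>P u *v q = P q *v u\<close>.\<close>

lemma ec_flux_consistent:
  assumes U: "near_linear X d (\<lambda>p. U p (i p)) m (\<lambda>p. U p (i p + 1))"
    and c: "coercive_on X (\<lambda>p. height (U p (i p)))" "coercive_on X (\<lambda>p. height (m p))"
      "coercive_on X (\<lambda>p. height (U p (i p + 1)))"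
    and d: "\<And>p. p \<in> X \<Longrightarrow> 0 \<le> d p \<and> d p \<le> 1"
  shows "bigo_on X (\<lambda>p. (d p)\<^sup>2) (\<lambda>p. ec_flux P g (U p) (i p) - sg_flux P g (m p))"
proof -
  let ?e = "\<lambda>p. (d p)\<^sup>2"
  let ?h = "\<lambda>p. height (m p)" and ?u = "\<lambda>p. velocity P (m p)"
  let ?hm = "\<lambda>p. avg (\<lambda>j. height (U p j)) (i p)" and ?um = "\<lambda>p. avg (\<lambda>j. velocity P (U p j)) (i p)"
  note nh = near_linear_linear[OF bounded_linear_height U]
  note nu = near_linear_velocity[OF U c]
  have e1: "bigo_on X (\<lambda>_. 1) f" if "bigo_on X ?e f" for f :: "'a \<Rightarrow> real ^ 'k"
    using d by (intro bigo_on_mono[OF that]) (auto simp: power_le_one)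
  have dh: "bigo_on X ?e (\<lambda>p. ?hm p - ?h p)" and du: "bigo_on X ?e (\<lambda>p. ?um p - ?u p)"
    unfolding avg_def by (rule near_linear_midpoint[OF nh] near_linear_midpoint[OF nu])+
  have h: "bigo_on X (\<lambda>_. 1) ?h" and u: "bigo_on X (\<lambda>_. 1) ?u"
    using nh nu by (auto simp: near_linear_def)
  have um: "bigo_on X (\<lambda>_. 1) ?um" using bigo_on_add[OF e1[OF du] u] by simp
  have q: "bigo_on X ?e (\<lambda>p. P (?hm p) *v ?um p - P (?h p) *v ?u p)"
    by (rule bigo_on_product_diff[OF bounded_bilinear dh du um h])
  have hu: "bigo_on X (\<lambda>_. 1) (\<lambda>p. P (?h p) *v ?u p)"
    using bigo_on_bilinear[OF bounded_bilinear h u] by simp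
  have qm: "bigo_on X (\<lambda>_. 1) (\<lambda>p. P (?hm p) *v ?um p)"
    using bigo_on_add[OF e1[OF q] hu] by simp
  have uq: "bigo_on X ?e (\<lambda>p. P (?um p) *v (P (?hm p) *v ?um p) - P (?u p) *v (P (?h p) *v ?u p))"
    by (rule bigo_on_product_diff[OF bounded_bilinear du q qm u])
  have hh: "bigo_on X ?e (\<lambda>p. avg (\<lambda>j. P (height (U p j)) *v height (U p j)) (i p) - P (?h p) *v ?h p)"
    unfolding avg_def by (rule near_linear_midpoint[OF near_linear_bilinear[OF bounded_bilinear nh nh d]])
  have "bigo_on X ?e (\<lambda>p. mk_state (P (?hm p) *v ?um p - P (?h p) *v ?u p)
      ((g / 2) *\<^sub>R (avg (\<lambda>j. P (height (U p j)) *v height (U p j)) (i p) - P (?h p) *v ?h p)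
       + (P (?um p) *v (P (?hm p) *v ?um p) - P (?u p) *v (P (?h p) *v ?u p))))"
    by (intro bigo_on_mk_state q bigo_on_add[OF bigo_on_scaleR[OF hh] uq])
  then show ?thesis
  proof (rule bigo_on_cong)
    fix p assume "p \<in> X"
    then have "P (?h p) *v ?u p = discharge (m p)"
      by (intro P_velocity coercive_on_pos_def[OF c(2)])
    then show "mk_state (P (?hm p) *v ?um p - P (?h p) *v ?u p)
      ((g / 2) *\<^sub>R (avg (\<lambda>j. P (height (U p j)) *v height (U p j)) (i p) - P (?h p) *v ?h p)
       + (P (?um p) *v (P (?hm p) *v ?um p) - P (?u p) *v (P (?h p) *v ?u p)))
      = ec_flux P g (U p) (i p) - sg_flux P g (m p)"
      by (simp add: ec_flux_def sg_flux_def Let_def mk_state_diff velocity_def[symmetric]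
          commute[of _ "velocity P (m p)"] algebra_simps)
  qed simp
qed

text \<open>The change of the scaled jump from one interface to the next splits into the transposed
  matrix applied to a second difference of \<open>V\<close>, and the change of the matrix applied to
  a first difference. Both are of second order.\<close>

lemma rec_scaled_jump_bigo:
  fixes R :: "'p \<Rightarrow> int \<Rightarrow> real ^ 'n ^ 'n::finite"
  assumes R: "bigo_on X (\<lambda>_. 1) (\<lambda>p. R p (i p))" "bigo_on X (\<lambda>_. 1) (\<lambda>p. R p (i p + 1))"
      "bigo_on X d (\<lambda>p. R p (i p) - R p (i p - 1))" "bigo_on X d (\<lambda>p. R p (i p + 1) - R p (i p))"
    and V: "near_linear X d (\<lambda>p. V p (i p - 1)) (\<lambda>p. V p (i p)) (\<lambda>p. V p (i p + 1))"
      "near_linear X d (\<lambda>p. V p (i p)) (\<lambda>p. V p (i p + 1)) (\<lambda>p. V p (i p + 2))"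
  shows "bigo_on X (\<lambda>p. (d p)\<^sup>2) (\<lambda>p. rec_scaled_jump (R p) (V p) (i p))"
proof -
  let ?w = "\<lambda>p. scaled_jump (R p) (V p)"
  note nl = V[unfolded near_linear_def]
  note transpose_diff = linear_diff[OF bounded_linear.linear[OF bounded_linear_transpose]]
  interpret M: bounded_bilinear "(*v) :: real ^ 'n ^ 'n \<Rightarrow> _" by (rule bounded_bilinear_matrix_vector)
  have mv: "bigo_on X (\<lambda>p. e p * e' p) (\<lambda>p. transpose (f p) *v f' p)"
    if "bigo_on X e f" "bigo_on X e' f'" for e e' f and f' :: "'p \<Rightarrow> real ^ 'n"
    by (intro bigo_on_bilinear[OF bounded_bilinear_matrix_vector] bigo_on_linear[OF bounded_linear_transpose] that)
  have "bigo_on X (\<lambda>p. 1 * (d p)\<^sup>2)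
      (\<lambda>p. transpose (R p (i p + 1)) *v (V p (i p) + V p (i p + 2) - 2 *\<^sub>R V p (i p + 1)))"
    using R(2) nl(2) by (intro mv) auto
  moreover have "bigo_on X (\<lambda>p. d p * d p)
      (\<lambda>p. transpose (R p (i p + 1) - R p (i p)) *v (V p (i p + 1) - V p (i p)))"
    using R(4) nl(1) by (intro mv) auto
  ultimately have "bigo_on X (\<lambda>p. (d p)\<^sup>2)
      (\<lambda>p. transpose (R p (i p + 1)) *v (V p (i p) + V p (i p + 2) - 2 *\<^sub>R V p (i p + 1))
        + transpose (R p (i p + 1) - R p (i p)) *v (V p (i p + 1) - V p (i p)))"
    by (simp add: power2_eq_square bigo_on_add)
  then have 1: "bigo_on X (\<lambda>p. (d p)\<^sup>2) (\<lambda>p. ?w p (i p + 1) - ?w p (i p))"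
    by (rule bigo_on_cong)
      (simp_all only: scaled_jump_eq jump_def transpose_diff M.add_right M.diff_left M.diff_right
        M.scaleR_right, simp_all add: scaleR_2 algebra_simps del: transpose_matrix_vector)
  have "bigo_on X (\<lambda>p. 1 * (d p)\<^sup>2)
      (\<lambda>p. transpose (R p (i p)) *v (V p (i p - 1) + V p (i p + 1) - 2 *\<^sub>R V p (i p)))"
    using R(1) nl(1) by (intro mv) auto
  moreover have "bigo_on X (\<lambda>p. d p * d p)
      (\<lambda>p. transpose (R p (i p) - R p (i p - 1)) *v (V p (i p - 1) - V p (i p)))"
    using R(3) nl(1) by (intro mv) auto
  ultimately have "bigo_on X (\<lambda>p. (d p)\<^sup>2)
      (\<lambda>p. transpose (R p (i p)) *v (V p (i p - 1) + V p (i p + 1) - 2 *\<^sub>R V p (i p))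
        - transpose (R p (i p) - R p (i p - 1)) *v (V p (i p - 1) - V p (i p)))"
    by (simp add: power2_eq_square bigo_on_diff)
  then have 2: "bigo_on X (\<lambda>p. (d p)\<^sup>2) (\<lambda>p. ?w p (i p) - ?w p (i p - 1))"
    by (rule bigo_on_cong)
      (simp_all only: scaled_jump_eq jump_def transpose_diff M.add_right M.diff_left M.diff_right
        M.scaleR_right, simp_all add: scaleR_2 algebra_simps del: transpose_matrix_vector)
  obtain C D where C: "\<And>p. p \<in> X \<Longrightarrow> norm (?w p (i p + 1) - ?w p (i p)) \<le> C * (d p)\<^sup>2"
    and D: "\<And>p. p \<in> X \<Longrightarrow> norm (?w p (i p) - ?w p (i p - 1)) \<le> D * (d p)\<^sup>2"
    using bigo_onE[OF 1] bigo_onE[OF 2] by metis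
  show ?thesis
  proof (rule bigo_onI)
    fix p assume p: "p \<in> X"
    have "norm (rec_scaled_jump (R p) (V p) (i p)) \<le> real CARD('n) * (C * (d p)\<^sup>2 + D * (d p)\<^sup>2)"
      by (rule order_trans[OF rec_scaled_jump_bound])
        (intro mult_left_mono add_mono C D p, simp)
    then show "norm (rec_scaled_jump (R p) (V p) (i p)) \<le> real CARD('n) * (C + D) * (d p)\<^sup>2"
      by (simp add: algebra_simps)
  qed
qed

text \<open>The conservative part is consistent, and the diffusion is a product of bounded
  eigenvector matrices, bounded eigenvalues and a second-order reconstructed jump.\<close>

lemma second_order_flux:
  fixes T L :: "'k state \<Rightarrow> 'k state_matrix"
  assumes eig: "\<And>U. pos_def (P (height U)) \<Longrightarrow>
      invertible (T U) \<and> diagonal (L U) \<and>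
      jacobian (sg_flux P g) (at U) = T U ** L U ** matrix_inv (T U)"
    and U: "smooth U" and B: "smooth B" and pd: "\<And>x. pos_def (P (height (U x)))"
    and coh: "coherent_eigenvectors P T U"
  shows "\<exists>C \<delta>. 0 < \<delta> \<and> (\<forall>dx x0 i. 0 < dx \<longrightarrow> dx < \<delta> \<longrightarrow> interface x0 dx i \<in> {a..b} \<longrightarrow>
      norm (es2_flux P g T L (cell_average x0 dx U) (cell_average x0 dx B) i
        - sg_flux P g (U (interface x0 dx i))) \<le> C * dx\<^sup>2)"
proof -
  define Ui where "Ui = (\<lambda>p :: real \<times> real \<times> int. cell_average (fst (snd p)) (fst p) U :: int \<Rightarrow> 'k state)"
  define Bi where "Bi = (\<lambda>p :: real \<times> real \<times> int. cell_average (fst (snd p)) (fst p) B :: int \<Rightarrow> real ^ 'k)"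
  define ix where "ix = (\<lambda>p :: real \<times> real \<times> int. snd (snd p))"
  define R where "R = (\<lambda>p j. T (roe_state P (Ui p) j))"
  define V where "V = (\<lambda>p j. entropy_var P g (Ui p j) (Bi p j))"
  define St where "St = (\<lambda>p. roe_state P (Ui p) (ix p))"
  \<comment> \<open>The right end is \<open>b + 1\<close> because the limiter also uses the matrix
    at interface \<open>i + 1\<close>, one mesh size further.\<close>
  obtain C0 \<delta>0 where coh': "0 < \<delta>0"
    "\<And>dx x0 i. 0 < dx \<Longrightarrow> dx < \<delta>0 \<Longrightarrow> interface x0 dx i \<in> {a..b + 1} \<Longrightarrow>
      norm (R (dx, x0, i) i) \<le> C0 \<and> norm (R (dx, x0, i) i - R (dx, x0, i) (i - 1)) \<le> C0 * dx"
    using coh unfolding coherent_eigenvectors_def Let_def R_def Ui_def fst_conv snd_conv by blast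
  \<comment> \<open>The bound on interfaces becomes one on cell centers, which lie half a cell to
    the left; this explains \<open>a - 1\<close>.\<close>
  define X where "X = {p \<in> mesh (a - 1) b. fst p < \<delta>0 \<and> interface (fst (snd p)) (fst p) (ix p) \<in> {a..b}}"
  have X: "X \<subseteq> mesh (a - 1) b" by (auto simp: X_def)
  have d: "0 < fst p \<and> fst p < 1 \<and> 0 \<le> fst p \<and> fst p \<le> 1" if "p \<in> X" for p
    using X that mesh_size by blast
  have R0: "norm (R p (ix p)) \<le> C0 * 1 \<and> norm (R p (ix p) - R p (ix p - 1)) \<le> C0 * fst p"
    and R1: "norm (R p (ix p + 1)) \<le> C0 * 1 \<and> norm (R p (ix p + 1) - R p (ix p)) \<le> C0 * fst p"
    if p: "p \<in> X" for p
  proof -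
    have R_eq: "R (fst p, fst (snd p), j) = R p" for j by (simp add: R_def Ui_def)
    have "interface (fst (snd p)) (fst p) (ix p + 1) = interface (fst (snd p)) (fst p) (ix p) + fst p"
      by (simp add: interface_def algebra_simps)
    then have "interface (fst (snd p)) (fst p) (ix p + 1) \<in> {a..b + 1}"
      "interface (fst (snd p)) (fst p) (ix p) \<in> {a..b + 1}"
      using p d[OF p] by (auto simp: X_def)
    with coh'(2)[of "fst p" "fst (snd p)" "ix p"] coh'(2)[of "fst p" "fst (snd p)" "ix p + 1"]
    show "norm (R p (ix p)) \<le> C0 * 1 \<and> norm (R p (ix p) - R p (ix p - 1)) \<le> C0 * fst p"
      "norm (R p (ix p + 1)) \<le> C0 * 1 \<and> norm (R p (ix p + 1) - R p (ix p)) \<le> C0 * fst p"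
      using p d[OF p] by (simp_all add: X_def R_eq)
  qed
  have U_eq: "avg_at U k p = Ui p (ix p + k)" and B_eq: "avg_at B k p = Bi p (ix p + k)" for k p
    by (simp_all add: avg_at_def Ui_def Bi_def ix_def)
  have cU: "coercive_on X (\<lambda>p. height (Ui p (ix p + k)))" for k
    using coercive_on_subset[OF coercive_on_avg_at[OF U pd, of "a - 1" b k] X] by (simp add: U_eq)
  have nU: "near_linear X fst (\<lambda>p. Ui p (ix p + (k - 1))) (\<lambda>p. Ui p (ix p + k)) (\<lambda>p. Ui p (ix p + (k + 1)))"
    and nB: "near_linear X fst (\<lambda>p. Bi p (ix p + (k - 1))) (\<lambda>p. Bi p (ix p + k)) (\<lambda>p. Bi p (ix p + (k + 1)))"
    for k
    using near_linear_subset[OF near_linear_cells[OF U, of "a - 1" b k] X]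
      near_linear_subset[OF near_linear_cells[OF B, of "a - 1" b k] X]
    by (simp_all add: U_eq[abs_def] B_eq[abs_def])
  have nV: "near_linear X fst (\<lambda>p. V p (ix p + (k - 1))) (\<lambda>p. V p (ix p + k)) (\<lambda>p. V p (ix p + (k + 1)))" for k
    unfolding V_def using d by (intro near_linear_entropy_var nU nB cU) auto
  have w: "bigo_on X (\<lambda>p. (fst p)\<^sup>2) (\<lambda>p. rec_scaled_jump (R p) (V p) (ix p))"
  proof (rule rec_scaled_jump_bigo)
    show "near_linear X fst (\<lambda>p. V p (ix p - 1)) (\<lambda>p. V p (ix p)) (\<lambda>p. V p (ix p + 1))"
      using nV[of 0] by simp
    show "near_linear X fst (\<lambda>p. V p (ix p)) (\<lambda>p. V p (ix p + 1)) (\<lambda>p. V p (ix p + 2))"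
      using nV[of 1] by simp
  qed (use R0 R1 in \<open>auto intro!: bigo_onI[where C = C0]\<close>)
  have nI: "near_linear X fst (\<lambda>p. Ui p (ix p)) (\<lambda>p. U (center p + (1 / 2) * fst p)) (\<lambda>p. Ui p (ix p + 1))"
    using near_linear_subset[OF near_linear_interface[OF U, of "a - 1" b] X] by (simp add: U_eq[abs_def])
  have cI: "coercive_on X (\<lambda>p. height (U (center p + (1 / 2) * fst p)))"
    by (rule coercive_on_subset[OF coercive_on_point[OF U pd] X])
  have c0: "coercive_on X (\<lambda>p. height (Ui p (ix p)))" "coercive_on X (\<lambda>p. height (Ui p (ix p + 1)))"
    using cU[of 0] cU[of 1] by simp_all
  have EC: "bigo_on X (\<lambda>p. (fst p)\<^sup>2)
      (\<lambda>p. ec_flux P g (Ui p) (ix p) - sg_flux P g (U (center p + (1 / 2) * fst p)))"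
    using d by (intro ec_flux_consistent nI cI c0) auto
  have St: "height (St p) = (1 / 2) *\<^sub>R (height (Ui p (ix p)) + height (Ui p (ix p + 1)))"
    "discharge (St p) = P (height (St p)) *v
       ((1 / 2) *\<^sub>R (velocity P (Ui p (ix p)) + velocity P (Ui p (ix p + 1))))" for p
    by (simp_all add: St_def roe_state_def avg_def Let_def)
  have cS: "coercive_on X (\<lambda>p. height (St p))"
    unfolding St(1) by (rule coercive_on_average[OF c0])
  \<comment> \<open>The Roe state is built so that its velocity is the mean velocity; this bounds
    the Jacobian there.\<close>
  have uS: "velocity P (St p) = (1 / 2) *\<^sub>R (velocity P (Ui p (ix p)) + velocity P (Ui p (ix p + 1)))"
    if "p \<in> X" for p
    by (intro velocity_unique coercive_on_pos_def[OF cS that] St(2)[symmetric])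
  note nh = near_linear_bounded[OF near_linear_linear[OF bounded_linear_height nI]]
  note nu = near_linear_bounded[OF near_linear_velocity[OF nI c0(1) cI c0(2)]]
  have hS: "bigo_on X (\<lambda>_. 1) (\<lambda>p. height (St p))"
    unfolding St(1) using d by (intro bigo_on_scaleR bigo_on_add nh) auto
  have uS': "bigo_on X (\<lambda>_. 1) (\<lambda>p. velocity P (St p))"
  proof (rule bigo_on_cong)
    show "bigo_on X (\<lambda>_. 1) (\<lambda>p. (1 / 2) *\<^sub>R (velocity P (Ui p (ix p)) + velocity P (Ui p (ix p + 1))))"
      using d by (intro bigo_on_scaleR bigo_on_add nu) auto
  qed (simp_all add: uS)
  have "bigo_on X (\<lambda>p. (fst p)\<^sup>2)
      (\<lambda>p. abs_entries (L (St p)) *v rec_scaled_jump (R p) (V p) (ix p))"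
    using eig coercive_on_pos_def[OF cS]
    by (intro bigo_on_abs_diagonal w eigenvalues_bigo[OF eig cS hS uS']) auto
  moreover have "bigo_on X (\<lambda>_. 1) (\<lambda>p. R p (ix p))"
    using R0 by (auto intro!: bigo_onI[where C = C0])
  ultimately have "bigo_on X (\<lambda>p. 1 * (fst p)\<^sup>2)
      (\<lambda>p. R p (ix p) *v (abs_entries (L (St p)) *v rec_scaled_jump (R p) (V p) (ix p)))"
    by (intro bigo_on_bilinear[OF bounded_bilinear_matrix_vector])
  then have "bigo_on X (\<lambda>p. (fst p)\<^sup>2)
      (\<lambda>p. (1 / 2) *\<^sub>R (R p (ix p) *v (abs_entries (L (St p)) *v rec_scaled_jump (R p) (V p) (ix p))))"
    by (intro bigo_on_scaleR) simp
  from bigo_on_diff[OF EC this] obtain C where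
    C: "\<And>p. p \<in> X \<Longrightarrow> norm (ec_flux P g (Ui p) (ix p) - sg_flux P g (U (center p + (1 / 2) * fst p))
      - (1 / 2) *\<^sub>R (R p (ix p) *v (abs_entries (L (St p)) *v rec_scaled_jump (R p) (V p) (ix p))))
      \<le> C * (fst p)\<^sup>2"
    unfolding bigo_on_def by blast
  have ES: "es2_flux P g T L (Ui p) (Bi p) (ix p) = ec_flux P g (Ui p) (ix p)
      - (1 / 2) *\<^sub>R (R p (ix p) *v (abs_entries (L (St p)) *v rec_scaled_jump (R p) (V p) (ix p)))"
    if p: "p \<in> X" for p
    using diffusion_rec_jump[of "R p" "ix p" "abs_entries (L (St p))" "V p"]
      eig[OF coercive_on_pos_def[OF cS p]]
    by (simp add: es2_flux_def Let_def R_def V_def St_def)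
  show ?thesis
  proof (rule exI[of _ C], rule exI[of _ "min \<delta>0 1"], intro conjI allI impI)
    show "0 < min \<delta>0 1" using coh'(1) by simp
    fix dx x0 :: real and i :: int
    assume dx: "0 < dx" "dx < min \<delta>0 1" and y: "interface x0 dx i \<in> {a..b}"
    define p where "p = (dx, x0, i)"
    have cp: "interface x0 dx i = center p + (1 / 2) * dx"
      by (simp add: p_def interface_def center_def cell_center_def algebra_simps)
    then have pX: "p \<in> X" using dx y by (auto simp: X_def mesh_def p_def ix_def)
    have "norm (es2_flux P g T L (Ui p) (Bi p) (ix p) - sg_flux P g (U (center p + (1 / 2) * fst p)))
        \<le> C * (fst p)\<^sup>2"
      unfolding ES[OF pX] by (subst cancel_ab_semigroup_add_class.diff_right_commute) (rule C[OF pX])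
    then show "norm (es2_flux P g T L (cell_average x0 dx U) (cell_average x0 dx B) i
        - sg_flux P g (U (interface x0 dx i))) \<le> C * dx\<^sup>2"
      unfolding cp by (simp add: p_def Ui_def Bi_def ix_def)
  qed
qed

end

section \<open>Truncation error of the source\<close>

context symmetric_trilinear begin

text \<open>Since the source is divided by the mesh size, its numerator has to be accurate to third
  order. The symmetric arrangement of the two interfaces around the cell center provides the
  additional order.\<close>

lemma second_order_source:
  assumes U: "smooth U" and B: "smooth B"
  shows "\<exists>C. \<forall>dx x0 i. 0 < dx \<longrightarrow> dx < 1 \<longrightarrow> cell_center x0 dx i \<in> {a..b} \<longrightarrow>
      norm (discrete_source P g dx (cell_average x0 dx U) (cell_average x0 dx B) i
        - sg_source P g (U (cell_center x0 dx i)) (vector_derivative B (at (cell_center x0 dx i))))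
      \<le> C * dx\<^sup>2"
proof -
  obtain DU where DU: "DU 0 = U" "\<And>n x. (DU n has_vector_derivative DU (Suc n) x) (at x)"
    using smoothE[OF U] by blast
  obtain DB where DB: "DB 0 = B" "\<And>n x. (DB n has_vector_derivative DB (Suc n) x) (at x)"
    using smoothE[OF B] by blast
  have dB: "vector_derivative B (at x) = DB 1 x" for x
    using DB(2)[of 0 x] by (simp add: DB(1) vector_derivative_at)
  let ?X = "mesh a b"
  define h where "h = (\<lambda>k p. height (avg_at U k p))"
  define \<beta> where "\<beta> = (\<lambda>k. avg_at B k)"
  define hc where "hc = (\<lambda>p. height (U (center p)))"
  define bc where "bc = (\<lambda>p. DB 1 (center p))"
  have hc: "bigo_on ?X (\<lambda>_. 1) hc" and bc: "bigo_on ?X (\<lambda>_. 1) bc"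
    using bigo_on_linear[OF bounded_linear_height derivatives_bigo[of DU, OF DU(2), where n = 0]]
      derivatives_bigo[of DB, OF DB(2), where n = 1]
    by (simp_all add: hc_def bc_def DU(1))
  have nh: "near_linear ?X fst (h (- 1)) (h 0) (h 1)"
    using near_linear_linear[OF bounded_linear_height near_linear_cells[OF U, of a b 0]]
    by (simp add: h_def)
  have nb: "near_linear ?X fst (\<beta> (- 1)) (\<beta> 0) (\<beta> 1)"
    using near_linear_cells[OF B, of a b 0] by (simp add: \<beta>_def)
  have h0: "bigo_on ?X (\<lambda>p. (fst p)\<^sup>2) (\<lambda>p. h 0 p - hc p)"
    using bigo_on_linear[OF bounded_linear_height avg_at_linear_expansion[of DU, OF DU(2), where k = 0]]
    by (simp add: h_def hc_def DU(1))
  \<comment> \<open>The sum of the two interface heights minus twice the height at the center,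
    arranged as a second difference plus the error of one cell average.\<close>
  define s where "s = (\<lambda>p. (1 / 2) *\<^sub>R (h (- 1) p + h 1 p - 2 *\<^sub>R h 0 p) + 2 *\<^sub>R (h 0 p - hc p))"
  have s: "bigo_on ?X (\<lambda>p. (fst p)\<^sup>2) s"
    unfolding s_def using nh by (intro bigo_on_add[OF bigo_on_scaleR bigo_on_scaleR] h0)
      (auto simp: near_linear_def)
  define t where "t = (\<lambda>p. (1 / 2) *\<^sub>R (h 1 p - h (- 1) p))"
  have "bigo_on ?X fst (\<lambda>p. (1 / 2) *\<^sub>R ((h 1 p - h 0 p) - (h (- 1) p - h 0 p)))"
    using nh unfolding near_linear_def by (intro bigo_on_scaleR[OF bigo_on_diff]) auto
  then have t: "bigo_on ?X fst t" by (simp add: t_def)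
  define y where "y = (\<lambda>p. \<beta> 1 p - \<beta> (- 1) p)"
  \<comment> \<open>In the difference of the averages at offsets \<open>1\<close> and
    \<open>- 1\<close> the even terms of the expansion cancel, the quadratic one included.\<close>
  have y: "bigo_on ?X (\<lambda>p. fst p ^ 3) (\<lambda>p. y p - (2 * fst p) *\<^sub>R bc p)"
  proof -
    define A where "A = (\<lambda>k p. avg_at B k p - B (center p) - (of_int k * fst p) *\<^sub>R DB 1 (center p)
        - (((of_int k)\<^sup>2 / 2 + 1 / 24) * (fst p)\<^sup>2) *\<^sub>R DB 2 (center p))"
    have "bigo_on ?X (\<lambda>p. fst p ^ 3) (\<lambda>p. A 1 p - A (- 1) p)"
      unfolding A_def DB(1)[symmetric] by (intro bigo_on_diff avg_at_expansion[of DB, OF DB(2)])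
    moreover have "A 1 p - A (- 1) p = y p - (2 * fst p) *\<^sub>R bc p" for p
    proof -
      have "(2 * fst p) *\<^sub>R bc p = fst p *\<^sub>R bc p + fst p *\<^sub>R bc p"
        by (simp add: scaleR_add_left[symmetric])
      then show ?thesis by (simp add: A_def y_def \<beta>_def bc_def)
    qed
    ultimately show ?thesis by simp
  qed
  have "bigo_on ?X fst (\<lambda>p. (\<beta> 1 p - \<beta> 0 p) - (\<beta> (- 1) p - \<beta> 0 p))"
    using bigo_on_diff[of ?X fst "\<lambda>p. \<beta> 1 p - \<beta> 0 p" "\<lambda>p. \<beta> (- 1) p - \<beta> 0 p"] nb
    by (simp add: near_linear_def)
  then have y1: "bigo_on ?X fst y" by (simp add: y_def)
  define z where "z = (\<lambda>p. \<beta> (- 1) p + \<beta> 1 p - 2 *\<^sub>R \<beta> 0 p)"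
  have z: "bigo_on ?X (\<lambda>p. (fst p)\<^sup>2) z" using nb by (simp add: near_linear_def z_def)
  note bb = bigo_on_bilinear[OF bounded_bilinear]
  have "bigo_on ?X (\<lambda>p. fst p ^ 3) (\<lambda>p. P (s p) *v y p)"
    using bb[OF s y1] by (simp add: power2_eq_square power3_eq_cube)
  moreover have "bigo_on ?X (\<lambda>p. fst p ^ 3) (\<lambda>p. 2 *\<^sub>R (P (hc p) *v (y p - (2 * fst p) *\<^sub>R bc p)))"
    using bb[OF hc y] by (intro bigo_on_scaleR) simp
  moreover have "bigo_on ?X (\<lambda>p. fst p ^ 3) (\<lambda>p. P (t p) *v z p)"
    using bb[OF t z] by (simp add: power2_eq_square power3_eq_cube mult.assoc)
  ultimately have "bigo_on ?X (\<lambda>p. fst p ^ 3)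
      (\<lambda>p. (1 / 2) *\<^sub>R (P (s p) *v y p + 2 *\<^sub>R (P (hc p) *v (y p - (2 * fst p) *\<^sub>R bc p)) + P (t p) *v z p))"
    by (intro bigo_on_scaleR[OF bigo_on_add[OF bigo_on_add]])
  then obtain C where C: "\<And>p. p \<in> ?X \<Longrightarrow> norm ((1 / 2) *\<^sub>R (P (s p) *v y p
      + 2 *\<^sub>R (P (hc p) *v (y p - (2 * fst p) *\<^sub>R bc p)) + P (t p) *v z p)) \<le> C * fst p ^ 3"
    unfolding bigo_on_def by blast
  define E where "E = (\<lambda>p. P ((1 / 2) *\<^sub>R (h 0 p + h 1 p)) *v (\<beta> 1 p - \<beta> 0 p)
      + P ((1 / 2) *\<^sub>R (h (- 1) p + h 0 p)) *v (\<beta> 0 p - \<beta> (- 1) p))"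
  text \<open>With \<open>X + Y = s + 2 hc\<close>, \<open>X - Y = t\<close> for the two averaged heights \<open>X\<close>, \<open>Y\<close> and \<open>y\<close>, \<open>z\<close> the
    sum and difference of the two jumps of the bottom, \<open>E\<close> is half of \<open>P(X + Y) y + P(X - Y) z\<close>.\<close>
  have E: "E p - (2 * fst p) *\<^sub>R (P (hc p) *v bc p) = (1 / 2) *\<^sub>R (P (s p) *v y p
      + 2 *\<^sub>R (P (hc p) *v (y p - (2 * fst p) *\<^sub>R bc p)) + P (t p) *v z p)" for p
  proof -
    define X where "X = (1 / 2) *\<^sub>R (h 0 p + h 1 p)"
    define Y where "Y = (1 / 2) *\<^sub>R (h (- 1) p + h 0 p)"
    define \<alpha> where "\<alpha> = \<beta> 1 p - \<beta> 0 p"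
    define \<gamma> where "\<gamma> = \<beta> 0 p - \<beta> (- 1) p"
    have 1: "s p = X + Y - 2 *\<^sub>R hc p" "t p = X - Y" "y p = \<alpha> + \<gamma>" "z p = \<alpha> - \<gamma>"
      by (simp_all add: s_def t_def y_def z_def X_def Y_def \<alpha>_def \<gamma>_def vec_eq_iff field_simps)
    have "P (s p) *v y p + 2 *\<^sub>R (P (hc p) *v (y p - c *\<^sub>R bc p)) + P (t p) *v z p
      = 2 *\<^sub>R (P X *v \<alpha> + P Y *v \<gamma>) - 2 *\<^sub>R (c *\<^sub>R (P (hc p) *v bc p))" for c
      unfolding 1 B.add_left B.add_right B.diff_left B.diff_right B.scaleR_left B.scaleR_right
      by (simp add: scaleR_2 algebra_simps)
    then show ?thesis
      by (simp add: E_def X_def[symmetric] Y_def[symmetric] \<alpha>_def[symmetric] \<gamma>_def[symmetric]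
          scaleR_diff_right)
  qed
  show ?thesis
  proof (intro exI[of _ "\<bar>g\<bar> / 2 * C"] allI impI)
    fix dx x0 :: real and i :: int
    assume dx: "0 < dx" "dx < 1" and x: "cell_center x0 dx i \<in> {a..b}"
    define p where "p = (dx, x0, i)"
    have cp: "cell_center x0 dx i = center p" by (simp add: p_def center_def)
    have p: "p \<in> ?X" using dx x cp by (simp add: mesh_def p_def)
    have "discrete_source P g dx (cell_average x0 dx U) (cell_average x0 dx B) i =
        mk_state 0 (- (g / (2 * dx)) *\<^sub>R E p)"
      by (simp add: discrete_source_def Let_def E_def h_def \<beta>_def avg_at_def p_def avg_def jump_def)
    moreover have "sg_source P g (U (center p)) (DB 1 (center p)) =
        mk_state 0 (- (g / (2 * dx)) *\<^sub>R ((2 * dx) *\<^sub>R (P (hc p) *v bc p)))"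
      using dx by (simp add: sg_source_def hc_def bc_def)
    ultimately have "discrete_source P g dx (cell_average x0 dx U) (cell_average x0 dx B) i
        - sg_source P g (U (center p)) (DB 1 (center p)) =
        mk_state 0 (- (g / (2 * dx)) *\<^sub>R (E p - (2 * dx) *\<^sub>R (P (hc p) *v bc p)))"
      by (simp only: mk_state_diff scaleR_diff_right diff_zero)
    then have "norm (discrete_source P g dx (cell_average x0 dx U) (cell_average x0 dx B) i
        - sg_source P g (U (center p)) (DB 1 (center p)))
        \<le> \<bar>g\<bar> / (2 * dx) * norm (E p - (2 * dx) *\<^sub>R (P (hc p) *v bc p))"
      using norm_state_le[of "mk_state 0 (- (g / (2 * dx)) *\<^sub>R (E p - (2 * dx) *\<^sub>R (P (hc p) *v bc p)))"] dx
      by (simp add: abs_mult)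
    also have "\<dots> \<le> \<bar>g\<bar> / (2 * dx) * (C * dx ^ 3)"
      using C[OF p] dx unfolding E[symmetric] by (intro mult_left_mono) (auto simp: p_def)
    also have "\<dots> = \<bar>g\<bar> / 2 * C * dx\<^sup>2"
      using dx by (simp add: power2_eq_square power3_eq_cube)
    finally show "norm (discrete_source P g dx (cell_average x0 dx U) (cell_average x0 dx B) i
        - sg_source P g (U (cell_center x0 dx i)) (vector_derivative B (at (cell_center x0 dx i))))
      \<le> \<bar>g\<bar> / 2 * C * dx\<^sup>2"
      unfolding cp dB .
  qed
qed

lemma second_order_es2:
  fixes T L :: "'k state \<Rightarrow> 'k state_matrix"
  assumes eig: "\<And>U. pos_def (P (height U)) \<Longrightarrow>
      invertible (T U) \<and> diagonal (L U) \<and>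
      jacobian (sg_flux P g) (at U) = T U ** L U ** matrix_inv (T U)"
    and U: "smooth U" and B: "smooth B" and pd: "\<And>x. pos_def (P (height (U x)))"
    and coh: "coherent_eigenvectors P T U"
  shows "second_order_on P g (es2_flux P g T L) (discrete_source P g) U B"
  unfolding second_order_on_def Let_def
proof (intro allI)
  fix a b
  have "\<exists>C \<delta>. 0 < \<delta> \<and> (\<forall>dx x0 i. 0 < dx \<longrightarrow> dx < \<delta> \<longrightarrow> interface x0 dx i \<in> {a..b} \<longrightarrow>
      norm (es2_flux P g T L (cell_average x0 dx U) (cell_average x0 dx B) i
        - sg_flux P g (U (interface x0 dx i))) \<le> C * dx\<^sup>2)"
    by (rule second_order_flux[OF eig U B pd coh])
  then obtain C \<delta> where C: "0 < \<delta>"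
    "\<forall>dx x0 i. 0 < dx \<longrightarrow> dx < \<delta> \<longrightarrow> interface x0 dx i \<in> {a..b} \<longrightarrow>
      norm (es2_flux P g T L (cell_average x0 dx U) (cell_average x0 dx B) i
        - sg_flux P g (U (interface x0 dx i))) \<le> C * dx\<^sup>2"
    by - (elim exE conjE, rule that)
  from second_order_source[OF U B, of a b g] obtain D where D:
    "\<forall>dx x0 i. 0 < dx \<longrightarrow> dx < 1 \<longrightarrow> cell_center x0 dx i \<in> {a..b} \<longrightarrow>
      norm (discrete_source P g dx (cell_average x0 dx U) (cell_average x0 dx B) i
        - sg_source P g (U (cell_center x0 dx i)) (vector_derivative B (at (cell_center x0 dx i))))
      \<le> D * dx\<^sup>2"
    by - (elim exE, rule that)
  have mx: "x \<le> max C D * dx\<^sup>2" if "x \<le> C * dx\<^sup>2 \<or> x \<le> D * dx\<^sup>2" for x dx :: real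
    using that by (metis max.cobounded1 max.cobounded2 mult_right_mono order_trans zero_le_power2)
  show "\<exists>C \<delta>. 0 < \<delta> \<and> (\<forall>dx x0 i. 0 < dx \<and> dx < \<delta> \<longrightarrow>
      (interface x0 dx i \<in> {a..b} \<longrightarrow>
        norm (es2_flux P g T L (cell_average x0 dx U) (cell_average x0 dx B) i
          - sg_flux P g (U (interface x0 dx i))) \<le> C * dx\<^sup>2) \<and>
      (cell_center x0 dx i \<in> {a..b} \<longrightarrow>
        norm (discrete_source P g dx (cell_average x0 dx U) (cell_average x0 dx B) i
          - sg_source P g (U (cell_center x0 dx i)) (vector_derivative B (at (cell_center x0 dx i))))
        \<le> C * dx\<^sup>2))"
  proof (rule exI[of _ "max C D"], rule exI[of _ "min \<delta> 1"], intro conjI allI impI)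
    show "0 < min \<delta> 1" using C(1) by simp
  qed (use C(2) D in \<open>auto intro!: mx\<close>)
qed

end

section \<open>The polynomial chaos matrices as a symmetric trilinear form\<close>

lemma pce_triple_symmetric:
  "pce_triple \<rho> \<phi> k $ l $ m = pce_triple \<rho> \<phi> m $ l $ k"
  "pce_triple \<rho> \<phi> k $ l $ m = pce_triple \<rho> \<phi> k $ m $ l"
  by (simp_all add: pce_triple_def inner_density_def mult_ac)

lemma pce_matrix_nth: "pce_matrix \<rho> \<phi> z $ l $ m = (\<Sum>k\<in>UNIV. z $ k * pce_triple \<rho> \<phi> k $ l $ m)"
  by (simp add: pce_matrix_def)

text \<open>The entries are integrals of products of three basis functions against the density,
  unchanged under any permutation of the indices.\<close>

lemma symmetric_trilinear_pce: "symmetric_trilinear (pce_matrix \<rho> \<phi>)"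
proof (rule symmetric_trilinear.intro)
  show "linear (pce_matrix \<rho> \<phi>)"
    by (rule linearI) (simp_all add: pce_matrix_def scaleR_add_left sum.distrib scaleR_sum_right)
  show "pce_matrix \<rho> \<phi> a *v b = pce_matrix \<rho> \<phi> b *v a" for a b
  proof -
    have "(\<Sum>m\<in>UNIV. \<Sum>k\<in>UNIV. a $ k * pce_triple \<rho> \<phi> k $ l $ m * b $ m)
        = (\<Sum>m\<in>UNIV. \<Sum>k\<in>UNIV. b $ k * pce_triple \<rho> \<phi> k $ l $ m * a $ m)" for l
      \<comment> \<open>Exchanging the sums and then the indices \<open>k\<close> and
        \<open>m\<close> of the triple product interchanges \<open>a\<close> and
        \<open>b\<close>.\<close>
      by (subst sum.swap, intro sum.cong refl, subst pce_triple_symmetric(1)) (simp add: mult_ac)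
    then show ?thesis
      by (simp add: vec_eq_iff matrix_vector_mult_def pce_matrix_nth sum_distrib_right)
  qed
  show "transpose (pce_matrix \<rho> \<phi> a) = pce_matrix \<rho> \<phi> a" for a
    by (simp add: vec_eq_iff transpose_def pce_matrix_nth pce_triple_symmetric(2))
qed

theorem theorem4p3:
  fixes M :: "'w measure"
    and \<xi> :: "'w \<Rightarrow> real ^ 'd::finite"
    and \<rho> :: "real ^ 'd \<Rightarrow> real"
    and \<phi> :: "'k::finite \<Rightarrow> real ^ 'd \<Rightarrow> real"
    and k1 :: 'k
    and g :: real
    and P :: "real ^ 'k \<Rightarrow> real ^ 'k ^ 'k"
    and T L :: "'k state \<Rightarrow> 'k state_matrix"
    and \<F> :: "(int \<Rightarrow> 'k state) \<Rightarrow> (int \<Rightarrow> real ^ 'k) \<Rightarrow> int \<Rightarrow> 'k state"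
    and S :: "real \<Rightarrow> (int \<Rightarrow> 'k state) \<Rightarrow> (int \<Rightarrow> real ^ 'k) \<Rightarrow> int \<Rightarrow> 'k state"
  assumes "prob_space M"
    and "distributed M lborel \<xi> (\<lambda>x. ennreal (\<rho> x))"
    and "\<And>x. 0 \<le> \<rho> x"
    and "\<And>p. real_polynomial_function p \<Longrightarrow> integrable lborel (\<lambda>x. p x * \<rho> x)"
    and "\<And>k. real_polynomial_function (\<phi> k)"
    and "\<phi> k1 = (\<lambda>x. 1)"
    and "\<And>k l. inner_density \<rho> (\<phi> k) (\<phi> l) = (if k = l then 1 else 0)"
    and "P = pce_matrix \<rho> \<phi>"
    and "0 < g"
    and "\<And>U. pos_def (P (height U)) \<Longrightarrow>
           invertible (T U) \<and> diagonal (L U) \<and>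
           jacobian (sg_flux P g) (at U) = T U ** L U ** matrix_inv (T U)"
    and "\<F> = es2_flux P g T L"
    and "S = discrete_source P g"
  shows "(\<forall>U B. smooth U \<longrightarrow> smooth B \<longrightarrow> (\<forall>x. pos_def (P (height (U x)))) \<longrightarrow>
             coherent_eigenvectors P T U \<longrightarrow> second_order_on P g \<F> S U B) \<and>
         well_balanced P (fv_rhs \<F> S) \<and>
         energy_stable P g (fv_rhs \<F> S)"
proof -
  interpret symmetric_trilinear P unfolding assms(8) by (rule symmetric_trilinear_pce)
  have "diagonalizing T L" using assms(10) by (simp add: diagonalizing_def)
  then show ?thesis
    unfolding assms(11,12)
    using second_order_es2[OF assms(10)] well_balanced_es2 energy_stable_es2
    by (intro conjI allI impI) auto
qed

end
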